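(* Let $\Psi\in\mathcal B_0$ satisfy, for all $u>0$ and $\gamma\ge1$, $$\underline c\,\gamma^{\underline\mu}\Psi(u)\le\Psi(\gamma u)\le\bar c\,\gamma^{\bar\mu}\Psi(u)$$ with constants $\underline c\in(0,1]$, $\bar c\in[1,\infty)$, $\underline\mu>0$ and $0<\bar\mu<\frac d2\wedge1$. Assume furthermore that the subordinate Brownian motion $(X_t)_{t\ge0}$ in $\mathbb R^d$ associated with $\Psi$ is transient. Then for every $p\in\big(1,\frac{d}{d-2\underline\mu}\big)$ there is no non-trivial, non-negative super-solution to $$\Psi(-\Delta)\varphi\ge\varphi^p\quad\text{in }\mathbb R^d.$$
   Context: $\mathcal B_0$ is the set of Bernstein functions $\Psi\in C^\infty((0,\infty))$ with $\Psi\ge0$, $(-1)^n\Psi^{(n)}\le0$ for all integers $n\ge1$, and $\lim_{u\downarrow0}\Psi(u)=0$. $(X_t)_{t\ge0}$ is the subordinate Brownian motion $X_t=B_{S_t}$ in $\mathbb R^d$, where $B$ is $d$-dimensional Brownian motion with $\mathbb E[e^{i\xi\cdot B_t}]=e^{-t|\xi|^2}$ and $S$ is an independent subordinator with $\mathbb E[e^{-uS_t}]=e^{-t\Psi(u)}$; $X$ is a Lévy process with generator $-\Psi(-\Delta)$. $\mathbb E^x$ refers to $X$ started at $x$. $X$ is transient if $\lim_{t\to\infty}|X_t|=\infty$ almost surely. $\mathscr B_r(x)$ is the ball of radius $r$ centred at $x$ and $\tau_{\mathscr B_r(x)}=\inf\{t>0:X_t\notin\mathscr B_r(x)\}$. A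 non-negative (weak) super-solution of $\Psi(-\Delta)\varphi\ge\varphi^p$ in $\mathbb R^d$ is a function $\varphi\in C(\mathbb R^d)$, $\varphi\ge0$, such that for all $x\in\mathbb R^d$, $r>0$, $t>0$, $$\varphi(x)\ge\mathbb E^x[\varphi(X_{t\wedge\tau_{\mathscr B_r(x)}})]+\mathbb E^x\Big[\int_0^{t\wedge\tau_{\mathscr B_r(x)}}\varphi^p(X_s)\,ds\Big].$$ *)

theory Defs
  imports "HOL-Probability.Probability"
begin

text \<open>
  Processes are families \<open>X t \<omega>\<close> with \<open>t :: real\<close>, of which only \<open>t \<ge> 0\<close> is used.
  Euclidean space of dimension \<open>d\<close> is a type \<open>'a :: euclidean_space\<close> with \<open>d = DIM('a)\<close>.
\<close>

text \<open>The class \<open>\<B>\<^sub>0\<close>; only the values of \<open>\<Psi>\<close> on \<open>(0,\<infinity>)\<close> matter.\<close>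

definition bernstein0 :: "(real \<Rightarrow> real) set" where
  "bernstein0 = {\<Psi>.
     (\<forall>n. (deriv ^^ n) \<Psi> differentiable_on {0<..}) \<and>
     (\<forall>u>0. \<Psi> u \<ge> 0) \<and>
     (\<forall>n\<ge>1. \<forall>u>0. (- 1) ^ n * (deriv ^^ n) \<Psi> u \<le> 0) \<and>
     (\<Psi> \<longlongrightarrow> 0) (at_right 0)}"

definition levy_process :: "'w measure \<Rightarrow> (real \<Rightarrow> 'w \<Rightarrow> 'a::euclidean_space) \<Rightarrow> bool" where
  "levy_process M X \<longleftrightarrow>
     prob_space M \<and>
     (\<forall>t\<ge>0. X t \<in> borel_measurable M) \<and>
     (AE \<omega> in M. X 0 \<omega> = 0) \<and>
     (\<forall>(\<sigma> :: nat \<Rightarrow> real) n. 0 \<le> \<sigma> 0 \<longrightarrow> mono \<sigma> \<longrightarrow>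
        prob_space.indep_vars M (\<lambda>_. borel) (\<lambda>i \<omega>. X (\<sigma> (Suc i)) \<omega> - X (\<sigma> i) \<omega>) {..<n}) \<and>
     (\<forall>s t. 0 \<le> s \<longrightarrow> s \<le> t \<longrightarrow>
        distr M borel (\<lambda>\<omega>. X t \<omega> - X s \<omega>) = distr M borel (X (t - s))) \<and>
     (AE \<omega> in M.
        (\<forall>t\<ge>0. ((\<lambda>s. X s \<omega>) \<longlongrightarrow> X t \<omega>) (at_right t)) \<and>
        (\<forall>t>0. \<exists>l. ((\<lambda>s. X s \<omega>) \<longlongrightarrow> l) (at_left t)))"

text \<open>Brownian motion with generator \<open>\<Delta>\<close> (not \<open>\<Delta>/2\<close>), started at the origin.\<close>

definition brownian_motion :: "'w measure \<Rightarrow> (real \<Rightarrow> 'w \<Rightarrow> 'a::euclidean_space) \<Rightarrow> bool" where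
  "brownian_motion M B \<longleftrightarrow>
     levy_process M B \<and>
     (AE \<omega> in M. continuous_on {0..} (\<lambda>t. B t \<omega>)) \<and>
     (\<forall>t\<ge>0. \<forall>\<xi>. (CLINT \<omega>|M. iexp (\<xi> \<bullet> B t \<omega>)) = of_real (exp (- t * (norm \<xi>)\<^sup>2)))"

definition subordinator :: "'w measure \<Rightarrow> (real \<Rightarrow> real) \<Rightarrow> (real \<Rightarrow> 'w \<Rightarrow> real) \<Rightarrow> bool" where
  "subordinator M \<Psi> S \<longleftrightarrow>
     levy_process M S \<and>
     (AE \<omega> in M. mono_on {0..} (\<lambda>t. S t \<omega>)) \<and>
     (\<forall>t\<ge>0. \<forall>u>0. (LINT \<omega>|M. exp (- u * S t \<omega>)) = exp (- t * \<Psi> u))"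

text \<open>The \<open>\<sigma>\<close>-algebras generated by the whole processes \<open>B\<close> and \<open>S\<close> are independent
  (\<open>indep_var\<close> is not applicable, since \<open>B\<close> and \<open>S\<close> have different value types).\<close>

definition subordinate_brownian_motion ::
    "'w measure \<Rightarrow> (real \<Rightarrow> real) \<Rightarrow> (real \<Rightarrow> 'w \<Rightarrow> 'a::euclidean_space) \<Rightarrow> bool" where
  "subordinate_brownian_motion M \<Psi> X \<longleftrightarrow>
     (\<exists>B S. brownian_motion M B \<and> subordinator M \<Psi> S \<and>
        prob_space.indep_set M
          (sets (vimage_algebra (space M) (\<lambda>\<omega>. \<lambda>t\<in>{0..}. B t \<omega>) (\<Pi>\<^sub>M t\<in>{0..}. borel)))
          (sets (vimage_algebra (space M) (\<lambda>\<omega>. \<lambda>t\<in>{0..}. S t \<omega>) (\<Pi>\<^sub>M t\<in>{0..}. borel))) \<and>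
        X = (\<lambda>t \<omega>. B (S t \<omega>) \<omega>))"

definition transient :: "'w measure \<Rightarrow> (real \<Rightarrow> 'w \<Rightarrow> 'a::euclidean_space) \<Rightarrow> bool" where
  "transient M X \<longleftrightarrow> (AE \<omega> in M. filterlim (\<lambda>t. norm (X t \<omega>)) at_top at_top)"

text \<open>First exit time of a path, \<open>\<infinity>\<close> if the path never leaves the set.\<close>

definition exit_time :: "(real \<Rightarrow> 'a) \<Rightarrow> 'a set \<Rightarrow> ereal" where
  "exit_time f U = (INF t\<in>{t. 0 < t \<and> f t \<notin> U}. ereal t)"

text \<open>The time \<open>t \<and> \<tau>\<close>, where \<open>\<tau>\<close> is the exit time of \<open>x + X\<close> from the ball of radius
  \<open>r\<close> around \<open>x\<close>.\<close>

definition stopped_time ::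
    "(real \<Rightarrow> 'w \<Rightarrow> 'a::euclidean_space) \<Rightarrow> 'a \<Rightarrow> real \<Rightarrow> real \<Rightarrow> 'w \<Rightarrow> real" where
  "stopped_time X x r t \<omega> =
     real_of_ereal (min (ereal t) (exit_time (\<lambda>s. x + X s \<omega>) (ball x r)))"

text \<open>
  Non-negative weak super-solutions of \<open>\<Psi>(-\<Delta>)\<phi> \<ge> \<phi>\<^sup>p\<close>, where \<open>X\<close> starts at the origin and
  generates \<open>-\<Psi>(-\<Delta>)\<close>; its law under \<open>\<P>\<^sup>x\<close> is that of \<open>x + X\<close>. The process leaves balls
  by jumps, so the first expectation need not be finite for an arbitrary continuous \<open>\<phi> \<ge> 0\<close>;
  integrals are therefore taken in \<open>[0,\<infinity>]\<close>.
\<close>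

definition super_solution ::
    "'w measure \<Rightarrow> (real \<Rightarrow> 'w \<Rightarrow> 'a::euclidean_space) \<Rightarrow> real \<Rightarrow> ('a \<Rightarrow> real) \<Rightarrow> bool" where
  "super_solution M X p \<phi> \<longleftrightarrow>
     continuous_on UNIV \<phi> \<and> (\<forall>x. 0 \<le> \<phi> x) \<and>
     (\<forall>x r t. 0 < r \<longrightarrow> 0 < t \<longrightarrow>
        ennreal (\<phi> x) \<ge>
          (\<integral>\<^sup>+\<omega>. ennreal (\<phi> (x + X (stopped_time X x r t \<omega>) \<omega>)) \<partial>M) +
          (\<integral>\<^sup>+\<omega>. (\<integral>\<^sup>+s\<in>{0..stopped_time X x r t \<omega>}.
              ennreal (\<phi> (x + X s \<omega>) powr p) \<partial>lborel) \<partial>M))"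

end

theory Submission imports Defs begin

text \<open>
  Letting the radius of the ball in the definition of a super-solution tend to infinity gives
  \<open>\<phi>(x) \<ge> \<integral>\<^sub>0\<^sup>t E[\<phi>\<^sup>p(x + X\<^sub>s)] ds\<close> for all \<open>x\<close> and \<open>t\<close>. For \<open>s\<close> between \<open>1/\<Psi>(R\<^sup>-\<^sup>2)\<close> and
  \<open>2/\<Psi>(R\<^sup>-\<^sup>2)\<close>, the Laplace transform and the lower scaling condition force \<open>S\<^sub>s\<close> to be
  comparable to \<open>R\<^sup>2\<close> with probability at least \<open>1/2\<close>, so the law of \<open>X\<^sub>s\<close> dominates a multiple
  of \<open>R\<^sup>-\<^sup>d\<close> times Lebesgue measure on the ball of radius \<open>2R\<close>. Hence, with
  \<open>I(R) = \<integral>\<phi>\<^sup>p\<close> over the ball of radius \<open>R\<close> around the origin,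
  \<open>\<phi> \<ge> C R\<^sup>-\<^sup>d I(R) / \<Psi>(R\<^sup>-\<^sup>2) \<ge> C' R\<^bsup>2\<mu>-d\<^esup> I(R)\<close> on that ball. Integrating the \<open>p\<close>-th power over
  the ball gives \<open>I(R)\<^bsup>p-1\<^esup> \<le> C'' R\<^bsup>-\<delta>\<^esup>\<close> with \<open>\<delta> = d - (d - 2\<mu>)p > 0\<close>; as \<open>I\<close> is increasing,
  it vanishes. Transience serves only to exclude \<open>\<Psi> = 0\<close>.
\<close>

section \<open>The Gauss-Weierstrass kernel\<close>

lemma integrable_gauss_1d:
  fixes e :: real assumes "e > 0"
  shows "integrable lborel (\<lambda>x. exp (- e * x\<^sup>2))"
proof -
  have "integrable lborel (\<lambda>x. sqrt (pi / e) * normal_density 0 (1 / sqrt (2 * e)) x)"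
    using assms by (intro integrable_mult_right integrable_normal_density) auto
  also have "(\<lambda>x. sqrt (pi / e) * normal_density 0 (1 / sqrt (2 * e)) x) = (\<lambda>x. exp (- e * x\<^sup>2))"
    using assms by (auto simp: normal_density_def power_divide real_sqrt_divide field_simps)
  finally show ?thesis .
qed

lemma fourier_gauss_1d:
  fixes e w :: real assumes "e > 0"
  shows "(CLINT x|lborel. of_real (exp (- e * x\<^sup>2)) * iexp (x * w))
     = of_real (sqrt (pi / e) * exp (- w\<^sup>2 / (4 * e)))"
proof -
  \<comment> \<open>\<open>c\<close> is the standard deviation of the Gaussian: substituting x = c y
    turns e x^2 into y^2 / 2, and the integral becomes the characteristic function of the standard
    normal law.\<close>
  define c where "c = 1 / sqrt (2 * e)"
  have c: "c > 0" "c\<^sup>2 = 1 / (2 * e)" using assms by (auto simp: c_def power_divide)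
  have eq: "of_real (exp (- e * (0 + c * y)\<^sup>2)) * iexp ((0 + c * y) * w)
      = complex_of_real (sqrt (2 * pi)) * (std_normal_density y *\<^sub>R iexp ((c * w) * y))" for y
    using c assms by (simp add: std_normal_density_def power_mult_distrib scaleR_conv_of_real mult_ac
      flip: of_real_mult)
  have "(CLINT x|lborel. of_real (exp (- e * x\<^sup>2)) * iexp (x * w))
     = \<bar>c\<bar> *\<^sub>R (CLINT y|lborel. of_real (exp (- e * (0 + c * y)\<^sup>2)) * iexp ((0 + c * y) * w))"
    by (rule lborel_integral_real_affine) (use c in auto)
  also have "\<dots> = of_real (c * sqrt (2 * pi)) *
      (CLINT y|lborel. std_normal_density y *\<^sub>R iexp ((c * w) * y))"
    unfolding eq using c by (simp add: scaleR_conv_of_real)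
  also have "(CLINT y|lborel. std_normal_density y *\<^sub>R iexp ((c * w) * y)) = char std_normal_distribution (c * w)"
    unfolding char_def by (subst integral_density) (auto intro!: borel_measurable_continuous_onI continuous_intros normal_density_nonneg)
  also have "\<dots> = of_real (exp (- (c * w)\<^sup>2 / 2))"
    by (simp add: char_std_normal_distribution)
  also have "- (c * w)\<^sup>2 / 2 = - w\<^sup>2 / (4 * e)"
    using c by (simp add: power_mult_distrib)
  also have "c * sqrt (2 * pi) = sqrt (pi / e)"
    using assms by (simp add: c_def real_sqrt_divide real_sqrt_mult)
  finally show ?thesis by (simp flip: of_real_mult) 
qed

text \<open>Lebesgue measure on \<open>'a\<close> is the image of the product of one-dimensional
  Lebesgue measures under summation along \<open>Basis\<close>, so Fubini for finite products
  applies. Values in a general field cover both the real Gaussian and its product with a complex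
  character.\<close>

lemma
  fixes f :: "'a::euclidean_space \<Rightarrow> real \<Rightarrow> 'b::{real_normed_field,banach,second_countable_topology}"
  assumes f: "\<And>b. b \<in> Basis \<Longrightarrow> integrable lborel (f b)"
  shows lborel_integrable_prod: "integrable lborel (\<lambda>x. \<Prod>b\<in>Basis. f b (x \<bullet> b))"
    and lborel_integral_prod: "(\<integral>x. (\<Prod>b\<in>Basis. f b (x \<bullet> b)) \<partial>lborel) = (\<Prod>b\<in>Basis. \<integral>x. f b x \<partial>lborel)"
proof -
  interpret product_sigma_finite "\<lambda>_::'a. lborel :: real measure"
    by standard
  have [measurable]: "f b \<in> borel_measurable borel" if "b \<in> Basis" for b
    using borel_measurable_integrable[OF f[OF that]] by simp
  have s: "(\<Sum>b\<in>Basis. g b *\<^sub>R b) \<bullet> c = g c" if "c \<in> Basis" for g and c :: 'a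
    using that by simp
  show "integrable lborel (\<lambda>x. \<Prod>b\<in>Basis. f b (x \<bullet> b))"
    unfolding lborel_eq[where 'a='a]
    by (subst integrable_distr_eq)
       (auto simp: s cong: prod.cong intro!: product_integrable_prod f)
  show "(\<integral>x. (\<Prod>b\<in>Basis. f b (x \<bullet> b)) \<partial>lborel) = (\<Prod>b\<in>Basis. \<integral>x. f b x \<partial>lborel)"
    unfolding lborel_eq[where 'a='a]
    by (subst integral_distr)
       (auto simp: s lborel_eq[symmetric] cong: prod.cong intro!: product_integral_prod f)
qed

lemma norm_sq_sum_Basis: "(norm (x::'a::euclidean_space))\<^sup>2 = (\<Sum>b\<in>Basis. (x \<bullet> b)\<^sup>2)"
  by (simp add: norm_eq_sqrt_inner euclidean_inner[of x x] power2_eq_square sum_nonneg)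

text \<open>Gaussian and character both factor over the coordinates, which reduces everything to
  dimension one.\<close>

lemma
  fixes w :: "'a::euclidean_space" assumes e: "e > 0"
  shows fourier_gauss: "(CLINT x|lborel. of_real (exp (- e * (norm x)\<^sup>2)) * iexp (x \<bullet> w))
     = of_real ((pi / e) powr (DIM('a) / 2) * exp (- (norm w)\<^sup>2 / (4 * e)))"
   and integrable_gauss: "integrable lborel (\<lambda>x::'a. exp (- e * (norm x)\<^sup>2))"
proof -
  have e1: "exp (- e * (norm x)\<^sup>2) = (\<Prod>b\<in>Basis. exp (- e * (x \<bullet> b)\<^sup>2))" for x :: 'a
    by (simp add: norm_sq_sum_Basis sum_distrib_left flip: exp_sum sum_negf)
  have e2: "iexp (x \<bullet> w) = (\<Prod>b\<in>Basis. iexp ((x \<bullet> b) * (w \<bullet> b)))" for x :: 'a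
    by (subst euclidean_inner) (simp add: sum_distrib_left flip: exp_sum)
  show "integrable lborel (\<lambda>x::'a. exp (- e * (norm x)\<^sup>2))"
    unfolding e1 by (rule lborel_integrable_prod) (rule integrable_gauss_1d[OF e])
  have i: "integrable lborel (\<lambda>x. of_real (exp (- e * x\<^sup>2)) * iexp (x * v))" for v
    by (rule Bochner_Integration.integrable_bound[OF integrable_gauss_1d[OF e]])
       (auto simp: norm_mult intro!: borel_measurable_continuous_onI continuous_intros)
  have "(CLINT x|lborel. of_real (exp (- e * (norm x)\<^sup>2)) * iexp (x \<bullet> w))
     = (CLINT x|lborel. (\<Prod>b\<in>Basis. of_real (exp (- e * (x \<bullet> b)\<^sup>2)) * iexp ((x \<bullet> b) * (w \<bullet> b))))"
    by (simp only: e1 e2 of_real_prod prod.distrib)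
  also have "\<dots> = (\<Prod>b\<in>(Basis::'a set). of_real (sqrt (pi / e) * exp (- (w \<bullet> b)\<^sup>2 / (4 * e))))"
    unfolding fourier_gauss_1d[OF e, symmetric] by (rule lborel_integral_prod) (rule i)
  also have "\<dots> = of_real (\<Prod>b\<in>(Basis::'a set). sqrt (pi / e) * exp (- (w \<bullet> b)\<^sup>2 / (4 * e)))"
    by simp
  also have "(\<Prod>b\<in>(Basis::'a set). sqrt (pi / e) * exp (- (w \<bullet> b)\<^sup>2 / (4 * e)))
     = (pi / e) powr (DIM('a) / 2) * exp (- (norm w)\<^sup>2 / (4 * e))"
    using e by (simp add: prod.distrib norm_sq_sum_Basis sum_divide_distrib powr_half_sqrt[symmetric]
      powr_powr flip: exp_sum sum_negf powr_realpow)
  finally show "(CLINT x|lborel. of_real (exp (- e * (norm x)\<^sup>2)) * iexp (x \<bullet> w))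
     = of_real ((pi / e) powr (DIM('a) / 2) * exp (- (norm w)\<^sup>2 / (4 * e)))" .
qed

section \<open>The heat kernel\<close>

text \<open>The density of the centred normal law with covariance 2t times the identity, which is
  the law at time \<open>t\<close> of Brownian motion with generator the Laplacian (not half of
  it).\<close>

definition heat_kernel :: "real \<Rightarrow> 'a::euclidean_space \<Rightarrow> real" where
  "heat_kernel t x = (4 * pi * t) powr (- real DIM('a) / 2) * exp (- (norm x)\<^sup>2 / (4 * t))"

lemma heat_kernel_nonneg: "0 \<le> heat_kernel t x"
  by (simp add: heat_kernel_def)

lemma measurable_heat_kernel[measurable]: "heat_kernel t \<in> borel_measurable borel"
  by (simp add: heat_kernel_def[abs_def])

text \<open>Only the prefactor of \<open>fourier_gauss\<close> has to be rewritten. Read from right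
  to left, the kernel becomes an integral of characters, into which the characteristic function of a
  random vector can be inserted.\<close>

lemma heat_kernel_fourier:
  fixes w :: "'a::euclidean_space" assumes e: "e > 0"
  shows "(CLINT x|lborel. of_real (exp (- e * (norm x)\<^sup>2)) * iexp (x \<bullet> w))
     = of_real ((2 * pi) powr DIM('a) * heat_kernel e w)"
proof -
  have "pi / e = (2 * pi)\<^sup>2 * inverse (4 * pi * e)"
    using e by (simp add: power2_eq_square field_simps)
  then have "(pi / e) powr (DIM('a) / 2) = ((2 * pi)\<^sup>2 * inverse (4 * pi * e)) powr (DIM('a) / 2)"
    by (simp only:)
  also have "\<dots> = ((2 * pi) powr 2) powr (DIM('a) / 2) * inverse (4 * pi * e) powr (DIM('a) / 2)"
    using e by (subst powr_mult) auto
  also have "((2 * pi) powr 2) powr (DIM('a) / 2) = (2 * pi) powr DIM('a)"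
    by (subst powr_powr) simp
  also have "inverse (4 * pi * e) powr (DIM('a) / 2) = (4 * pi * e) powr (- real DIM('a) / 2)"
    unfolding minus_divide_left[symmetric] powr_minus by (rule inverse_powr)
  finally show ?thesis by (simp only: fourier_gauss[OF e] heat_kernel_def mult.assoc)
qed

lemma heat_kernel_scale:
  assumes "t > 0" shows "heat_kernel t (sqrt t *\<^sub>R y) * sqrt t ^ DIM('a) = heat_kernel 1 (y::'a::euclidean_space)"
proof -
  have "sqrt t ^ DIM('a) = t powr (DIM('a) / 2)"
    using assms by (simp add: powr_half_sqrt[symmetric] powr_powr flip: powr_realpow)
  then show ?thesis using assms
    by (simp add: heat_kernel_def power_mult_distrib powr_mult powr_minus field_simps)
qed

text \<open>The substitution z = x + sqrt t y moves the time parameter from the kernel into the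
  argument of \<open>f\<close>; the reference measure then stays fixed while \<open>t\<close> tends
  to 0.\<close>

lemma nn_integral_heat_kernel:
  fixes f :: "'a::euclidean_space \<Rightarrow> ennreal"
  assumes t: "t > 0" and [measurable]: "f \<in> borel_measurable borel"
  shows "(\<integral>\<^sup>+z. f z * heat_kernel t (z - x) \<partial>lborel) = (\<integral>\<^sup>+y. f (x + sqrt t *\<^sub>R y) * heat_kernel 1 y \<partial>lborel)"
proof -
  have "(\<integral>\<^sup>+z. f z * heat_kernel t (z - x) \<partial>lborel)
     = (\<integral>\<^sup>+z. f z * heat_kernel t (z - x) \<partial>density (distr lborel borel (\<lambda>y. x + sqrt t *\<^sub>R y)) (\<lambda>_. \<bar>sqrt t\<bar>^DIM('a)))"
    by (subst lborel_affine[of "sqrt t" x, symmetric]) (use t in auto)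
  also have "\<dots> = (\<integral>\<^sup>+y. ennreal (\<bar>sqrt t\<bar>^DIM('a)) * (f (x + sqrt t *\<^sub>R y) * heat_kernel t (sqrt t *\<^sub>R y)) \<partial>lborel)"
    by (subst nn_integral_density) (auto simp: nn_integral_distr)
  also have "\<dots> = (\<integral>\<^sup>+y. f (x + sqrt t *\<^sub>R y) * heat_kernel 1 y \<partial>lborel)"
    using t by (intro nn_integral_cong)
      (simp add: heat_kernel_nonneg mult_ac ennreal_mult heat_kernel_scale[symmetric])
  finally show ?thesis .
qed

lemma nn_integral_heat_kernel_1: "(\<integral>\<^sup>+y. heat_kernel 1 (y::'a::euclidean_space) \<partial>lborel) = 1"
proof -
  \<comment> \<open>\<open>K\<close> is the one-dimensional normalising factor: the kernel at time 1
    is a product of normal densities of variance 2.\<close>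
  define K where "K = 1 / sqrt (4 * pi)"
  have "(4 * pi) powr (- real DIM('a) / 2) = ((4 * pi) powr (- (1 / 2))) powr DIM('a)"
    by (subst powr_powr) simp
  also have "(4 * pi) powr (- (1 / 2)) = K"
    unfolding K_def powr_minus by (subst powr_half_sqrt) (auto simp: inverse_eq_divide)
  also have "K powr DIM('a) = K ^ DIM('a)"
    by (rule powr_realpow) (simp add: K_def)
  finally have K: "(4 * pi) powr (- real DIM('a) / 2) = K ^ DIM('a)" .
  have n: "normal_density 0 (sqrt 2) s = K * exp (- s\<^sup>2 / 4)" for s
    by (simp add: normal_density_def K_def)
  have "heat_kernel 1 y = (\<Prod>b\<in>Basis. normal_density 0 (sqrt 2) (y \<bullet> b))" for y :: 'a
    unfolding n prod.distrib heat_kernel_def norm_sq_sum_Basis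
    by (simp add: K[simplified] sum_divide_distrib flip: exp_sum sum_negf)
  moreover have "(\<integral>\<^sup>+x. ennreal (normal_density 0 (sqrt 2) x) \<partial>lborel) = 1"
    by (subst nn_integral_eq_integral) auto
  ultimately show ?thesis
    by (simp flip: prod_ennreal) (subst nn_integral_lborel_prod, auto)
qed

text \<open>The prefactor decreases in \<open>q\<close> and the exponential increases, so the upper
  bound on \<open>q\<close> controls the former and the lower bound the latter. The extra 1 leaves
  room for rounding times up to a grid; \<open>1 \<le> R\<close> absorbs it into a multiple of
  R^2.\<close>

lemma heat_kernel_lower_bound:
  fixes z :: "'a::euclidean_space"
  assumes "0 < a" "0 \<le> b" "1 \<le> R" "a * R\<^sup>2 \<le> q" "q \<le> b * R\<^sup>2 + 1" "norm z \<le> 2 * R"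
  shows "(4 * pi * (b + 1)) powr (- real DIM('a) / 2) * exp (- 1 / a) * R powr (- real DIM('a)) \<le> heat_kernel q z"
proof -
  have R: "R > 0" "1 \<le> R\<^sup>2" using assms by auto
  have q: "0 < q" using assms R by (smt (verit) mult_pos_pos zero_less_power)
  have "4 * pi * q \<le> 4 * pi * (b + 1) * R\<^sup>2"
  proof -
    have "q \<le> b * R\<^sup>2 + R\<^sup>2" using assms(5) R(2) by linarith
    then have "q \<le> (b + 1) * R\<^sup>2" by (simp only: distrib_right mult_1)
    then have "(4 * pi) * q \<le> (4 * pi) * ((b + 1) * R\<^sup>2)" by (intro mult_left_mono) auto
    then show ?thesis by (simp only: mult.assoc)
  qed
  then have "(4 * pi * (b + 1) * R\<^sup>2) powr (- real DIM('a) / 2) \<le> (4 * pi * q) powr (- real DIM('a) / 2)"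
    using q by (intro powr_mono2') auto
  also have "(4 * pi * (b + 1) * R\<^sup>2) powr (- real DIM('a) / 2)
     = (4 * pi * (b + 1)) powr (- real DIM('a) / 2) * (R\<^sup>2) powr (- real DIM('a) / 2)"
    by (rule powr_mult)
  also have "(R\<^sup>2) powr (- real DIM('a) / 2) = (R powr 2) powr (- real DIM('a) / 2)"
    using R by simp
  also have "\<dots> = R powr (- real DIM('a))"
    by (subst powr_powr) simp
  finally have 1: "(4 * pi * (b + 1)) powr (- real DIM('a) / 2) * R powr (- real DIM('a))
    \<le> (4 * pi * q) powr (- real DIM('a) / 2)" .
  have "(norm z)\<^sup>2 \<le> (2 * R)\<^sup>2" using assms by (intro power_mono) auto
  then have "(norm z)\<^sup>2 / (4 * q) \<le> (2 * R)\<^sup>2 / (4 * (a * R\<^sup>2))"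
    using assms R q by (intro frac_le) auto
  also have "\<dots> = 1 / a" using R assms by (simp add: field_simps)
  finally have 2: "exp (- 1 / a) \<le> exp (- (norm z)\<^sup>2 / (4 * q))" by simp
  show ?thesis
    using mult_mono[OF 1 2] by (simp add: heat_kernel_def mult_ac)
qed

section \<open>Random vectors with Gaussian characteristic function\<close>

text \<open>Writing the kernel as a Fourier integral and exchanging the integrals by Fubini brings
  in the characteristic function of \<open>W\<close>, whose parameter \<open>q\<close> adds to
  \<open>e\<close>.\<close>

lemma (in prob_space) nn_integral_heat_kernel_diff:
  fixes W :: "'a \<Rightarrow> 'b::euclidean_space"
  assumes [measurable]: "W \<in> borel_measurable M"
    and char: "\<And>\<xi>. (CLINT \<omega>|M. iexp (\<xi> \<bullet> W \<omega>)) = of_real (exp (- q * (norm \<xi>)\<^sup>2))"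
    and q: "0 \<le> q" and e: "0 < e"
  shows "(\<integral>\<^sup>+\<omega>. heat_kernel e (z - W \<omega>) \<partial>M) = heat_kernel (q + e) z"
proof -
  interpret P: pair_sigma_finite M "lborel :: 'b measure" by standard
  let ?c = "(2 * pi) powr DIM('b)"
  let ?g = "\<lambda>\<omega> x. of_real (exp (- e * (norm x)\<^sup>2)) * iexp (x \<bullet> (z - W \<omega>))"
  have [measurable]: "(\<lambda>(\<omega>, x). ?g \<omega> x) \<in> borel_measurable (M \<Otimes>\<^sub>M lborel)"
    by measurable
  have ng: "norm (?g \<omega> x) = exp (- e * (norm x)\<^sup>2)" for \<omega> x
    by (simp add: norm_mult)
  \<comment> \<open>The modulus of the integrand is the Gaussian in \<open>x\<close>, independent of
    \<omega>; it is integrable since \<open>e\<close> is positive.\<close>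
  have int: "integrable (M \<Otimes>\<^sub>M lborel) (\<lambda>(\<omega>, x). ?g \<omega> x)"
  proof (rule P.Fubini_integrable)
    show "AE \<omega> in M. integrable lborel (\<lambda>x. case (\<omega>, x) of (\<omega>, x) \<Rightarrow> ?g \<omega> x)"
      unfolding prod.case
      by (intro AE_I2 Bochner_Integration.integrable_bound[OF integrable_gauss[OF e]])
        (auto simp: norm_mult)
    show "integrable M (\<lambda>\<omega>. LINT x|lborel. norm (case (\<omega>, x) of (\<omega>, x) \<Rightarrow> ?g \<omega> x))"
      unfolding prod.case ng by simp
  qed measurable
  have "integrable M (\<lambda>\<omega>. heat_kernel e (z - W \<omega>))"
    by (rule integrable_const_bound[of _ "(4 * pi * e) powr (- real DIM('b) / 2)"])
      (use e in \<open>auto simp: heat_kernel_def intro!: mult_left_le\<close>)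
  then have "(\<integral>\<^sup>+\<omega>. heat_kernel e (z - W \<omega>) \<partial>M) = ennreal (LINT \<omega>|M. heat_kernel e (z - W \<omega>))"
    by (intro nn_integral_eq_integral) (auto simp: heat_kernel_nonneg)
  also have "(LINT \<omega>|M. heat_kernel e (z - W \<omega>)) = heat_kernel (q + e) z"
  proof -
    have "complex_of_real (?c * (LINT \<omega>|M. heat_kernel e (z - W \<omega>)))
      = (CLINT \<omega>|M. of_real (?c * heat_kernel e (z - W \<omega>)))"
      by simp
    also have "\<dots> = (CLINT \<omega>|M. CLINT x|lborel. ?g \<omega> x)"
      by (simp only: heat_kernel_fourier[OF e])
    also have "\<dots> = (CLINT x|lborel. CLINT \<omega>|M. ?g \<omega> x)"
      using P.Fubini_integral[OF int] by simp
    also have "\<dots> = (CLINT x|lborel. of_real (exp (- (q + e) * (norm x)\<^sup>2)) * iexp (x \<bullet> z))"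
    proof (intro Bochner_Integration.integral_cong refl)
      fix x
      have "(CLINT \<omega>|M. ?g \<omega> x)
        = (CLINT \<omega>|M. (of_real (exp (- e * (norm x)\<^sup>2)) * iexp (x \<bullet> z)) * iexp ((- x) \<bullet> W \<omega>))"
        by (intro Bochner_Integration.integral_cong refl)
          (simp add: inner_diff_right right_diff_distrib mult.assoc flip: exp_add)
      also have "\<dots> = of_real (exp (- e * (norm x)\<^sup>2)) * iexp (x \<bullet> z) * of_real (exp (- q * (norm x)\<^sup>2))"
        using char[of "- x"] by simp
      finally show "(CLINT \<omega>|M. ?g \<omega> x) = of_real (exp (- (q + e) * (norm x)\<^sup>2)) * iexp (x \<bullet> z)"
        by (simp add: algebra_simps exp_diff exp_minus field_simps exp_add)
    qed
    also have "\<dots> = of_real (?c * heat_kernel (q + e) z)"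
      by (rule heat_kernel_fourier) (use q e in simp)
    finally show ?thesis
      by (subst (asm) of_real_eq_iff) simp
  qed
  finally show ?thesis .
qed

lemma prob_space_heat_kernel: "prob_space (density lborel (\<lambda>y::'a::euclidean_space. ennreal (heat_kernel 1 y)))"
  by standard (simp add: emeasure_density nn_integral_heat_kernel_1)

text \<open>Smoothing by an independent small Gaussian replaces the uniqueness theorem for
  multivariate characteristic functions; Fatou's lemma removes the smoothing.\<close>

lemma (in prob_space) nn_integral_heat_kernel_le:
  fixes W :: "'a \<Rightarrow> 'b::euclidean_space" and f :: "'b \<Rightarrow> real"
  assumes [measurable]: "W \<in> borel_measurable M"
    and char: "\<And>\<xi>. (CLINT \<omega>|M. iexp (\<xi> \<bullet> W \<omega>)) = of_real (exp (- q * (norm \<xi>)\<^sup>2))"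
    and q: "0 < q"
    and f: "continuous_on UNIV f" "\<And>x. 0 \<le> f x" "\<And>x. f x \<le> K"
  shows "(\<integral>\<^sup>+z. ennreal (f z) * ennreal (heat_kernel q z) \<partial>lborel) \<le> (\<integral>\<^sup>+\<omega>. f (W \<omega>) \<partial>M)"
proof -
  define G where "G = density lborel (\<lambda>y::'b. ennreal (heat_kernel 1 y))"
  interpret G: prob_space G
    unfolding G_def by (rule prob_space_heat_kernel)
  have [measurable_cong]: "sets G = sets borel" by (simp add: G_def)
  interpret P: pair_sigma_finite M "lborel :: 'b measure" by standard
  interpret PG: pair_prob_space M G by standard
  have [measurable]: "f \<in> borel_measurable borel"
    using f(1) by (rule borel_measurable_continuous_onI)
  define e where "e n = inverse (real (Suc n))" for n
  have e: "e n > 0" for n by (simp add: e_def)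
  have e0: "e \<longlonglongrightarrow> 0" unfolding e_def by (rule LIMSEQ_inverse_real_of_nat)
  let ?h = "\<lambda>n (\<omega>, y). ennreal (f (W \<omega> + sqrt (e n) *\<^sub>R y))"
  \<comment> \<open>\<open>heat_kernel (q + e n)\<close> is the density of \<open>W\<close> plus
    sqrt (e n) times an independent vector with density \<open>heat_kernel 1\<close>; the product
    space with \<open>G\<close> realises that sum.\<close>
  have eq: "(\<integral>\<^sup>+z. ennreal (f z) * ennreal (heat_kernel (q + e n) z) \<partial>lborel) = (\<integral>\<^sup>+p. ?h n p \<partial>(M \<Otimes>\<^sub>M G))" for n
  proof -
    have "(\<integral>\<^sup>+z. ennreal (f z) * ennreal (heat_kernel (q + e n) z) \<partial>lborel)
       = (\<integral>\<^sup>+z. (\<integral>\<^sup>+\<omega>. ennreal (f z) * ennreal (heat_kernel (e n) (z - W \<omega>)) \<partial>M) \<partial>lborel)"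
      using q e by (simp add: nn_integral_cmult nn_integral_heat_kernel_diff[OF _ char, symmetric] less_imp_le)
    also have "\<dots> = (\<integral>\<^sup>+\<omega>. (\<integral>\<^sup>+z. ennreal (f z) * ennreal (heat_kernel (e n) (z - W \<omega>)) \<partial>lborel) \<partial>M)"
      by (rule P.Fubini') measurable
    also have "\<dots> = (\<integral>\<^sup>+\<omega>. (\<integral>\<^sup>+y. ?h n (\<omega>, y) \<partial>G) \<partial>M)"
      using e by (simp add: nn_integral_heat_kernel G_def nn_integral_density mult.commute)
    also have "\<dots> = (\<integral>\<^sup>+p. ?h n p \<partial>(M \<Otimes>\<^sub>M G))"
      by (rule G.nn_integral_fst) measurable
    finally show ?thesis .
  qed
  have "(\<lambda>n. \<integral>\<^sup>+p. ?h n p \<partial>(M \<Otimes>\<^sub>M G)) \<longlonglongrightarrow> (\<integral>\<^sup>+p. (case p of (\<omega>, y) \<Rightarrow> ennreal (f (W \<omega>))) \<partial>(M \<Otimes>\<^sub>M G))"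
  proof (rule nn_integral_dominated_convergence[where w="\<lambda>_. ennreal K"])
    show "AE p in M \<Otimes>\<^sub>M G. ?h n p \<le> ennreal K" for n
      using f by (auto intro!: AE_I2 ennreal_leI)
    have "(\<lambda>n. f (w + sqrt (e n) *\<^sub>R y)) \<longlonglongrightarrow> f w" for w y
    proof (rule continuous_on_tendsto_compose[OF f(1)])
      have "(\<lambda>n. w + sqrt (e n) *\<^sub>R y) \<longlonglongrightarrow> w + sqrt 0 *\<^sub>R y"
        by (intro tendsto_intros e0)
      then show "(\<lambda>n. w + sqrt (e n) *\<^sub>R y) \<longlonglongrightarrow> w" by simp
    qed auto
    then show "AE p in M \<Otimes>\<^sub>M G. (\<lambda>n. ?h n p) \<longlonglongrightarrow> (case p of (\<omega>, y) \<Rightarrow> ennreal (f (W \<omega>)))"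
      by (auto intro!: AE_I2 tendsto_ennrealI)
    show "(\<integral>\<^sup>+p. ennreal K \<partial>(M \<Otimes>\<^sub>M G)) < \<infinity>"
      by (simp add: PG.emeasure_space_1)
  qed (measurable)
  also have "(\<integral>\<^sup>+p. (case p of (\<omega>, y) \<Rightarrow> ennreal (f (W \<omega>))) \<partial>(M \<Otimes>\<^sub>M G)) = (\<integral>\<^sup>+\<omega>. f (W \<omega>) \<partial>M)"
    by (subst G.nn_integral_fst[symmetric]) (auto simp: G.emeasure_space_1)
  finally have lim: "(\<lambda>n. \<integral>\<^sup>+z. ennreal (f z) * ennreal (heat_kernel (q + e n) z) \<partial>lborel) \<longlonglongrightarrow> (\<integral>\<^sup>+\<omega>. f (W \<omega>) \<partial>M)"
    unfolding eq .
  have hk: "(\<lambda>n. ennreal (f z) * ennreal (heat_kernel (q + e n) z)) \<longlonglongrightarrow> ennreal (f z) * ennreal (heat_kernel q z)" for z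
  proof -
    have "(\<lambda>n. f z * heat_kernel (q + e n) z) \<longlonglongrightarrow> f z * heat_kernel (q + 0) z"
      unfolding heat_kernel_def by (intro tendsto_intros e0) (use q in auto)
    then show ?thesis
      using f by (simp add: heat_kernel_nonneg tendsto_ennrealI flip: ennreal_mult)
  qed
  have "(\<integral>\<^sup>+z. ennreal (f z) * ennreal (heat_kernel q z) \<partial>lborel)
     = (\<integral>\<^sup>+z. liminf (\<lambda>n. ennreal (f z) * ennreal (heat_kernel (q + e n) z)) \<partial>lborel)"
    by (intro nn_integral_cong) (simp add: lim_imp_Liminf[OF _ hk])
  also have "\<dots> \<le> liminf (\<lambda>n. \<integral>\<^sup>+z. ennreal (f z) * ennreal (heat_kernel (q + e n) z) \<partial>lborel)"
    by (rule nn_integral_liminf) measurable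
  also have "\<dots> = (\<integral>\<^sup>+\<omega>. f (W \<omega>) \<partial>M)"
    by (rule lim_imp_Liminf[OF _ lim]) simp
  finally show ?thesis .
qed

section \<open>Subordination of a continuous process\<close>

text \<open>Floor plus one, not the ceiling: even when \<open>t\<close> is a grid point the value is
  strictly larger, as convergence within \<open>at_right t\<close> demands. For fixed
  \<open>n\<close> only countably many values occur.\<close>

definition grid_above :: "nat \<Rightarrow> real \<Rightarrow> real" where
  "grid_above n t = (of_int \<lfloor>real (Suc n) * t\<rfloor> + 1) / real (Suc n)"

lemma grid_above_bounds: "t < grid_above n t" "grid_above n t \<le> t + inverse (real (Suc n))"
proof -
  obtain N where N: "N = real (Suc n)" "N > 0" by simp
  have fl: "N * t < of_int \<lfloor>N * t\<rfloor> + 1" "of_int \<lfloor>N * t\<rfloor> \<le> N * t"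
    by linarith+
  show "t < grid_above n t"
    using fl(1) N(2) unfolding grid_above_def N(1)[symmetric]
    by (simp add: pos_less_divide_eq mult.commute)
  have "(of_int \<lfloor>N * t\<rfloor> + 1) / N \<le> (N * t + 1) / N"
    using fl(2) N(2) by (intro divide_right_mono) auto
  also have "\<dots> = t + inverse N"
    using N(2) by (simp add: add_divide_distrib inverse_eq_divide)
  finally show "grid_above n t \<le> t + inverse (real (Suc n))"
    unfolding grid_above_def N(1) .
qed

lemma filterlim_grid_above: "filterlim (\<lambda>n. grid_above n t) (at_right t) sequentially"
proof -
  have "(\<lambda>n. t + inverse (real (Suc n))) \<longlonglongrightarrow> t + 0"
    by (intro tendsto_add tendsto_const LIMSEQ_inverse_real_of_nat)
  then have u: "(\<lambda>n. t + inverse (real (Suc n))) \<longlonglongrightarrow> t"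
    by (simp only: add_0_right)
  have "(\<lambda>n. grid_above n t) \<longlonglongrightarrow> t"
    by (rule tendsto_sandwich[OF _ _ tendsto_const u])
      (intro always_eventually allI less_imp_le grid_above_bounds)+
  moreover have "grid_above n t \<in> {t<..} \<and> grid_above n t \<noteq> t" for n
  proof
    show "grid_above n t \<in> {t<..}" using grid_above_bounds(1) by simp
    then show "grid_above n t \<noteq> t" by (metis greaterThan_iff less_irrefl)
  qed
  ultimately show ?thesis
    unfolding filterlim_at by (intro conjI always_eventually allI) blast+
qed

text \<open>Replacing the time by its \<open>grid_above n\<close> gives maps that depend on time
  only through an integer, hence are jointly measurable by countability; right continuity makes them
  converge to \<open>Y\<close> at every point.\<close>

lemma measurable_pair_right_continuous:
  fixes Y :: "real \<Rightarrow> 'w \<Rightarrow> 'b::metric_space"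
  assumes Y: "\<And>t. Y t \<in> borel_measurable M"
    and rc: "\<And>\<omega> t. \<omega> \<in> space M \<Longrightarrow> ((\<lambda>s. Y s \<omega>) \<longlongrightarrow> Y t \<omega>) (at_right t)"
  shows "(\<lambda>p. Y (fst p) (snd p)) \<in> borel_measurable (borel \<Otimes>\<^sub>M M)"
proof (rule borel_measurable_LIMSEQ_metric)
  fix n
  have [measurable]: "Y t \<in> borel_measurable M" for t by fact
  have "(\<lambda>p. (\<lambda>k p. Y ((of_int k + 1) / real (Suc n)) (snd p)) \<lfloor>real (Suc n) * fst p\<rfloor> p) \<in> borel_measurable (borel \<Otimes>\<^sub>M M)"
    by (rule measurable_compose_countable) measurable
  then show "(\<lambda>p. Y (grid_above n (fst p)) (snd p)) \<in> borel_measurable (borel \<Otimes>\<^sub>M M)"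
    by (simp add: grid_above_def)
next
  fix p assume "p \<in> space (borel \<Otimes>\<^sub>M M :: (real \<times> 'w) measure)"
  then have "snd p \<in> space M" by (auto simp: space_pair_measure)
  then show "(\<lambda>n. Y (grid_above n (fst p)) (snd p)) \<longlonglongrightarrow> Y (fst p) (snd p)"
    by (rule filterlim_compose[OF rc filterlim_grid_above])
qed

text \<open>A version of the pair \<open>(B, S)\<close> whose path properties hold on all of the sample space.\<close>

locale subordination = prob_space M for M :: "'w measure" +
  fixes B :: "real \<Rightarrow> 'w \<Rightarrow> 'a::euclidean_space" and S :: "real \<Rightarrow> 'w \<Rightarrow> real" and \<Psi> :: "real \<Rightarrow> real"
  assumes measurable_B[measurable]: "\<And>t. B t \<in> borel_measurable M"
    and measurable_S[measurable]: "\<And>t. S t \<in> borel_measurable M"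
    and continuous_B: "\<And>\<omega>. \<omega> \<in> space M \<Longrightarrow> continuous_on UNIV (\<lambda>t. B t \<omega>)"
    and right_continuous_S: "\<And>\<omega> t. \<omega> \<in> space M \<Longrightarrow> ((\<lambda>s. S s \<omega>) \<longlongrightarrow> S t \<omega>) (at_right t)"
    and mono_S: "\<And>\<omega> s t. \<omega> \<in> space M \<Longrightarrow> s \<le> t \<Longrightarrow> S s \<omega> \<le> S t \<omega>"
    and nonneg_S: "\<And>\<omega> t. \<omega> \<in> space M \<Longrightarrow> 0 \<le> S t \<omega>"
    and char_B: "\<And>t \<xi>. 0 \<le> t \<Longrightarrow> (CLINT \<omega>|M. iexp (\<xi> \<bullet> B t \<omega>)) = of_real (exp (- t * (norm \<xi>)\<^sup>2))"
    and laplace_S: "\<And>t u. 0 \<le> t \<Longrightarrow> 0 < u \<Longrightarrow> (LINT \<omega>|M. exp (- u * S t \<omega>)) = exp (- t * \<Psi> u)"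
    and indep_B_S: "\<And>s t A C. 0 \<le> s \<Longrightarrow> 0 \<le> t \<Longrightarrow> A \<in> sets borel \<Longrightarrow> C \<in> sets borel \<Longrightarrow>
      prob {\<omega> \<in> space M. B t \<omega> \<in> A \<and> S s \<omega> \<in> C}
        = prob {\<omega> \<in> space M. B t \<omega> \<in> A} * prob {\<omega> \<in> space M. S s \<omega> \<in> C}"
begin

section \<open>The subordinate process and the use of independence\<close>

definition X :: "real \<Rightarrow> 'w \<Rightarrow> 'a" where "X t \<omega> = B (S t \<omega>) \<omega>"

text \<open>\<open>X\<close> is the jointly measurable map \<open>B\<close> evaluated at the random
  time \<open>S\<close>, with \<omega> carried along as second component. Fubini over time and
  \<omega> relies on this later.\<close>

lemma measurable_X_pair[measurable]:
  "(\<lambda>p. X (fst p) (snd p)) \<in> borel_measurable (borel \<Otimes>\<^sub>M M)"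
proof -
  have [measurable]: "(\<lambda>p. S (fst p) (snd p)) \<in> borel_measurable (borel \<Otimes>\<^sub>M M)"
    by (intro measurable_pair_right_continuous measurable_S right_continuous_S)
  have [measurable]: "(\<lambda>p. B (fst p) (snd p)) \<in> borel_measurable (borel \<Otimes>\<^sub>M M)"
    by (intro measurable_pair_right_continuous measurable_B
        continuous_on_tendsto_compose[OF continuous_B]) auto
  have "(\<lambda>q. B (fst q) (snd q)) \<circ> (\<lambda>p. (S (fst p) (snd p), snd p)) \<in> borel_measurable (borel \<Otimes>\<^sub>M M)"
    by (rule measurable_comp[where N = "borel \<Otimes>\<^sub>M M"]) measurable
  then show ?thesis by (simp add: X_def comp_def)
qed

lemma measurable_X[measurable]: "X t \<in> borel_measurable M"
proof -
  have "(\<lambda>p. X (fst p) (snd p)) \<circ> (\<lambda>\<omega>. (t, \<omega>)) \<in> borel_measurable M"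
    by (rule measurable_comp[where N = "borel \<Otimes>\<^sub>M M"]) measurable
  then show ?thesis by (simp add: comp_def)
qed

text \<open>Restricting \<open>M\<close> to the event for \<open>S s\<close> only scales the law of
  \<open>B t\<close>, because by independence both measures agree on every Borel set. Integrating
  \<open>f\<close> against them gives the product form.\<close>

lemma nn_integral_B_indicator_S:
  assumes "0 \<le> s" "0 \<le> t" and [measurable]: "f \<in> borel_measurable borel" "C \<in> sets borel"
  shows "(\<integral>\<^sup>+\<omega>. f (B t \<omega>) * indicator C (S s \<omega>) \<partial>M)
     = (\<integral>\<^sup>+\<omega>. f (B t \<omega>) \<partial>M) * emeasure M {\<omega> \<in> space M. S s \<omega> \<in> C}"
proof -
  let ?D = "density M (\<lambda>\<omega>. indicator C (S s \<omega>))" and ?P = "emeasure M {\<omega> \<in> space M. S s \<omega> \<in> C}"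
  have "distr ?D borel (B t) = scale_measure ?P (distr M borel (B t))"
  proof (rule measure_eqI)
    fix A assume "A \<in> sets (distr ?D borel (B t))"
    then have [measurable]: "A \<in> sets borel" by simp
    have "emeasure (distr ?D borel (B t)) A
      = (\<integral>\<^sup>+\<omega>. indicator {\<omega> \<in> space M. B t \<omega> \<in> A \<and> S s \<omega> \<in> C} \<omega> \<partial>M)"
      by (subst emeasure_distr)
        (auto simp: emeasure_density simp del: nn_integral_indicator
          intro!: nn_integral_cong split: split_indicator)
    also have "\<dots> = ennreal (prob {\<omega> \<in> space M. B t \<omega> \<in> A \<and> S s \<omega> \<in> C})"
      by (simp add: emeasure_eq_measure)
    also have "\<dots> = ?P * emeasure (distr M borel (B t)) A"
      using indep_B_S[OF assms(1,2), of A C]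
      by (simp add: emeasure_eq_measure emeasure_distr ennreal_mult vimage_def Int_def conj_commute mult.commute)
    finally show "emeasure (distr ?D borel (B t)) A = emeasure (scale_measure ?P (distr M borel (B t))) A"
      by simp
  qed simp
  then have "(\<integral>\<^sup>+x. f x \<partial>distr ?D borel (B t)) = (\<integral>\<^sup>+x. f x \<partial>scale_measure ?P (distr M borel (B t)))"
    by simp
  then show ?thesis
    by (simp add: nn_integral_distr nn_integral_density nn_integral_scale_measure mult.commute)
qed

lemma nn_integral_indicator_S:
  assumes [measurable]: "C \<in> sets borel"
  shows "(\<integral>\<^sup>+\<omega>. indicator C (S s \<omega>) \<partial>M) = emeasure M {\<omega> \<in> space M. S s \<omega> \<in> C}"
proof -
  have "(\<integral>\<^sup>+\<omega>. indicator C (S s \<omega>) \<partial>M) = (\<integral>\<^sup>+\<omega>. indicator {\<omega> \<in> space M. S s \<omega> \<in> C} \<omega> \<partial>M)"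
    by (intro nn_integral_cong) (simp split: split_indicator)
  then show ?thesis by simp
qed

text \<open>Rounding \<open>S\<close> up to a grid leaves only countably many times at which \<open>B\<close> is evaluated, so that
  independence applies termwise.\<close>

lemma nn_integral_X_ge:
  assumes s: "0 \<le> s" and ab: "0 < a"
    and f: "continuous_on UNIV f" "\<And>x. 0 \<le> f x" "\<And>x. f x \<le> K"
    and m: "\<And>q. a \<le> q \<Longrightarrow> q \<le> b + 1 \<Longrightarrow> m \<le> (\<integral>\<^sup>+\<omega>. ennreal (f (B q \<omega>)) \<partial>M)"
  shows "m * emeasure M {\<omega> \<in> space M. S s \<omega> \<in> {a<..b}} \<le> (\<integral>\<^sup>+\<omega>. ennreal (f (X s \<omega>)) \<partial>M)"
proof -
  have [measurable]: "f \<in> borel_measurable borel"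
    using f(1) by (rule borel_measurable_continuous_onI)
  define I where "I = {a<..b}"
  have [measurable]: "I \<in> sets borel" by (simp add: I_def)
  let ?g = "\<lambda>n \<omega>. ennreal (f (B (grid_above n (S s \<omega>)) \<omega>)) * indicator I (S s \<omega>)"
  have [measurable]: "(\<lambda>\<omega>. B (grid_above n (S s \<omega>)) \<omega>) \<in> borel_measurable M" for n
  proof -
    have "(\<lambda>\<omega>. (\<lambda>k \<omega>. B ((of_int k + 1) / real (Suc n)) \<omega>) \<lfloor>real (Suc n) * S s \<omega>\<rfloor> \<omega>) \<in> borel_measurable M"
      by (rule measurable_compose_countable) measurable
    then show ?thesis by (simp add: grid_above_def)
  qed
  have ge: "m * emeasure M {\<omega> \<in> space M. S s \<omega> \<in> I} \<le> (\<integral>\<^sup>+\<omega>. ?g n \<omega> \<partial>M)" for n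
  proof -
    \<comment> \<open>With mesh 1 / (n + 1), \<open>J\<close> indexes all grid cells that can meet
      \<open>I\<close>, \<open>C k\<close> is the part of \<open>I\<close> in cell \<open>k\<close>,
      and \<open>q k\<close> is the right endpoint of that cell, where \<open>B\<close> is
      evaluated.\<close>
    define J where "J = {\<lfloor>real (Suc n) * a\<rfloor>..\<lfloor>real (Suc n) * b\<rfloor>}"
    define C where "C k = {v \<in> I. \<lfloor>real (Suc n) * v\<rfloor> = k}" for k
    define q where "q k = (of_int k + 1) / real (Suc n)" for k :: int
    have [measurable]: "C k \<in> sets borel" for k
    proof -
      have "C k = I \<inter> ((\<lambda>v. \<lfloor>real (Suc n) * v\<rfloor>) -` {k} \<inter> space borel)" by (auto simp: C_def)
      also have "\<dots> \<in> sets borel" by measurable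
      finally show ?thesis .
    qed
    \<comment> \<open>Rounding up overshoots by at most one mesh width, hence by at most 1; this is
      why the assumption on \<open>m\<close> reaches up to \<open>b + 1\<close>.\<close>
    have q: "a \<le> q k" "q k \<le> b + 1" "0 \<le> q k" if "k \<in> J" for k
    proof -
      have "real (Suc n) * a < of_int k + 1" "of_int k \<le> real (Suc n) * b"
        using that unfolding J_def by (auto simp: le_floor_iff floor_le_iff)
      moreover from this have "of_int k + 1 \<le> real (Suc n) * (b + 1)"
        by (simp add: algebra_simps)
      ultimately show "a \<le> q k" "q k \<le> b + 1"
        unfolding q_def by (simp_all add: field_simps)
      then show "0 \<le> q k" using ab by simp
    qed
    \<comment> \<open>Stated for general \<open>h\<close> because it is used twice: with the
      constant \<open>m\<close> to split the left-hand side, and with the values of \<open>f\<close>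
      at the grid times to reassemble the integral.\<close>
    have ind: "indicator I v * h \<lfloor>real (Suc n) * v\<rfloor> = (\<Sum>k\<in>J. h k * indicator (C k) v)" for v and h :: "int \<Rightarrow> ennreal"
    proof (cases "v \<in> I")
      case True
      then have J: "\<lfloor>real (Suc n) * v\<rfloor> \<in> J"
        unfolding J_def I_def by (auto intro!: floor_mono mult_left_mono)
      have "(\<Sum>k\<in>J. h k * indicator (C k) v) = (\<Sum>k\<in>J. if k = \<lfloor>real (Suc n) * v\<rfloor> then h k else 0)"
        using True by (intro sum.cong) (auto simp: C_def)
      also have "\<dots> = h \<lfloor>real (Suc n) * v\<rfloor>"
        using J by (subst sum.delta) (auto simp: J_def)
      finally show ?thesis using True by simp
    qed (auto simp: C_def)
    have "m * emeasure M {\<omega> \<in> space M. S s \<omega> \<in> I} = (\<integral>\<^sup>+\<omega>. indicator I (S s \<omega>) * m \<partial>M)"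
      by (subst nn_integral_multc) (simp_all add: nn_integral_indicator_S mult.commute)
    also have "\<dots> = (\<Sum>k\<in>J. m * emeasure M {\<omega> \<in> space M. S s \<omega> \<in> C k})"
      by (simp only: ind[of _ "\<lambda>_. m"]) (subst nn_integral_sum, simp_all add: nn_integral_cmult nn_integral_indicator_S)
    also have "\<dots> \<le> (\<Sum>k\<in>J. (\<integral>\<^sup>+\<omega>. ennreal (f (B (q k) \<omega>)) \<partial>M) * emeasure M {\<omega> \<in> space M. S s \<omega> \<in> C k})"
      by (intro sum_mono mult_right_mono m q) auto
    also have "\<dots> = (\<Sum>k\<in>J. \<integral>\<^sup>+\<omega>. ennreal (f (B (q k) \<omega>)) * indicator (C k) (S s \<omega>) \<partial>M)"
      by (intro sum.cong refl nn_integral_B_indicator_S[symmetric] s q) measurable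
    also have "\<dots> = (\<integral>\<^sup>+\<omega>. (\<Sum>k\<in>J. ennreal (f (B (q k) \<omega>)) * indicator (C k) (S s \<omega>)) \<partial>M)"
      by (subst nn_integral_sum) auto
    also have "\<dots> = (\<integral>\<^sup>+\<omega>. ?g n \<omega> \<partial>M)"
      unfolding ind[symmetric] by (simp add: q_def grid_above_def mult.commute)
    finally show ?thesis .
  qed
  have "(\<lambda>n. \<integral>\<^sup>+\<omega>. ?g n \<omega> \<partial>M) \<longlonglongrightarrow> (\<integral>\<^sup>+\<omega>. ennreal (f (X s \<omega>)) * indicator I (S s \<omega>) \<partial>M)"
  proof (rule nn_integral_dominated_convergence[where w="\<lambda>_. ennreal K"])
    show "AE \<omega> in M. ?g n \<omega> \<le> ennreal K" for n
      using f by (auto intro!: AE_I2 ennreal_leI split: split_indicator)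
    have "(\<lambda>n. f (B (grid_above n (S s \<omega>)) \<omega>)) \<longlonglongrightarrow> f (X s \<omega>)" if "\<omega> \<in> space M" for \<omega>
      unfolding X_def
      by (intro continuous_on_tendsto_compose[OF f(1)] continuous_on_tendsto_compose[OF continuous_B[OF that]])
        (use filterlim_grid_above in \<open>auto simp: filterlim_at\<close>)
    then show "AE \<omega> in M. (\<lambda>n. ?g n \<omega>) \<longlonglongrightarrow> ennreal (f (X s \<omega>)) * indicator I (S s \<omega>)"
      by (intro AE_I2) (auto intro!: tendsto_ennrealI split: split_indicator)
    show "(\<integral>\<^sup>+\<omega>. ennreal K \<partial>M) < \<infinity>"
      by (simp add: emeasure_space_1)
  qed (measurable)
  then have "m * emeasure M {\<omega> \<in> space M. S s \<omega> \<in> I} \<le> (\<integral>\<^sup>+\<omega>. ennreal (f (X s \<omega>)) * indicator I (S s \<omega>) \<partial>M)"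
    by (rule LIMSEQ_le_const) (use ge in blast)
  also have "\<dots> \<le> (\<integral>\<^sup>+\<omega>. ennreal (f (X s \<omega>)) \<partial>M)"
    by (intro nn_integral_mono) (auto split: split_indicator)
  finally show ?thesis by (simp add: I_def)
qed

section \<open>Tail bounds for the subordinator\<close>

lemma integrable_exp_S: "0 < v \<Longrightarrow> integrable M (\<lambda>\<omega>. exp (- v * S s \<omega>))"
  by (rule integrable_const_bound[of _ 1]) (auto intro!: AE_I2 nonneg_S mult_nonneg_nonneg)

text \<open>Markov's inequality for exp (- v S), whose expectation is the Laplace transform.\<close>

lemma prob_S_le:
  assumes "0 \<le> s" "0 < v"
  shows "prob {\<omega> \<in> space M. S s \<omega> \<le> 1 / v} \<le> exp (1 - s * \<Psi> v)"
proof -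
  have "prob {\<omega> \<in> space M. S s \<omega> \<le> 1 / v} \<le> prob {\<omega> \<in> space M. exp (- 1) \<le> exp (- v * S s \<omega>)}"
    using assms(2) by (intro finite_measure_mono) (auto simp: field_simps)
  also have "\<dots> \<le> (LINT \<omega>|M. exp (- v * S s \<omega>)) / exp (- 1)"
    by (rule integral_Markov_inequality_measure[where A = "space M", OF integrable_exp_S[OF assms(2)]]) auto
  also have "\<dots> = exp (1 - s * \<Psi> v)"
    by (simp only: laplace_S[OF assms]) (simp add: exp_diff[symmetric])
  finally show ?thesis .
qed

text \<open>Markov's inequality for 1 - exp (- v S), which is at least 1/2 once S > 1/v because exp
  (- 1) \<le> 1/2; then 1 - exp (- y) \<le> y.\<close>

lemma prob_S_gt:
  assumes "0 \<le> s" "0 < v"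
  shows "prob {\<omega> \<in> space M. 1 / v < S s \<omega>} \<le> 2 * (s * \<Psi> v)"
proof -
  have i: "integrable M (\<lambda>\<omega>. 1 - exp (- v * S s \<omega>))"
    by (intro Bochner_Integration.integrable_diff integrable_exp_S assms) simp
  have e2: "exp (- 1 :: real) \<le> 1 / 2"
    using exp_ge_add_one_self[of 1] by (simp add: exp_minus field_simps)
  have "prob {\<omega> \<in> space M. 1 / v < S s \<omega>} \<le> prob {\<omega> \<in> space M. 1 / 2 \<le> 1 - exp (- v * S s \<omega>)}"
  proof (intro finite_measure_mono subsetI)
    fix \<omega> assume "\<omega> \<in> {\<omega> \<in> space M. 1 / v < S s \<omega>}"
    then have "\<omega> \<in> space M" "exp (- v * S s \<omega>) \<le> exp (- 1)"
      using assms(2) by (auto simp: field_simps)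
    moreover from this e2 have "1 / 2 \<le> 1 - exp (- v * S s \<omega>)" by linarith
    ultimately show "\<omega> \<in> {\<omega> \<in> space M. 1 / 2 \<le> 1 - exp (- v * S s \<omega>)}" by blast
  qed measurable
  also have "\<dots> \<le> (LINT \<omega>|M. 1 - exp (- v * S s \<omega>)) / (1 / 2)"
    using assms by (intro integral_Markov_inequality_measure[where A = "space M", OF i])
      (auto intro!: AE_I2 mult_nonneg_nonneg nonneg_S)
  also have "(LINT \<omega>|M. 1 - exp (- v * S s \<omega>)) = 1 - exp (- s * \<Psi> v)"
    using integrable_exp_S[OF assms(2), of s] laplace_S[OF assms]
    by (subst Bochner_Integration.integral_diff) (simp_all add: prob_space)
  also have "(1 - exp (- s * \<Psi> v)) / (1 / 2) \<le> 2 * (s * \<Psi> v)"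
    using exp_ge_add_one_self[of "- s * \<Psi> v"] by simp
  finally show ?thesis .
qed

text \<open>The endpoints are chosen such that \<open>\<Psi>\<close> at their reciprocals is at least \<open>3 \<Psi>(u)\<close> and at most
  \<open>\<Psi>(u)/16\<close>, respectively.\<close>

lemma prob_S_interval:
  assumes c: "0 < c" "c \<le> 1" and \<mu>: "0 < \<mu>"
    and scaling: "\<And>u \<gamma>. 0 < u \<Longrightarrow> 1 \<le> \<gamma> \<Longrightarrow> c * \<gamma> powr \<mu> * \<Psi> u \<le> \<Psi> (\<gamma> * u)"
    and u: "0 < u" "0 < \<Psi> u" and s: "1 / \<Psi> u \<le> s" "s \<le> 2 / \<Psi> u"
  shows "1 / 2 \<le> prob {\<omega> \<in> space M. S s \<omega> \<in> {(c / 3) powr (1 / \<mu>) / u<..(16 / c) powr (1 / \<mu>) / u}}"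
    (is "_ \<le> prob {\<omega> \<in> space M. S s \<omega> \<in> {?a / u<..?b / u}}")
proof -
  have s0: "0 \<le> s" using s(1) u(2) by (meson divide_nonneg_pos le_less order_trans zero_le_one)
  \<comment> \<open>The factors 3 and 16 make each tail at most 1/4 when \<open>s * \<Psi> u\<close>
    lies between 1 and 2: the lower tail is at most exp (1 - 3), the upper one at most 2 * 2 /
    16.\<close>
  have a: "0 < ?a" "?a \<le> 1" using c \<mu> by (auto intro!: powr_le1)
  have b: "1 \<le> ?b" "0 < ?b" using c \<mu> by (auto intro!: ge_one_powr_ge_zero)
  have "c * (1 / ?a) powr \<mu> * \<Psi> u \<le> \<Psi> (1 / ?a * u)"
    using a u by (intro scaling) (auto simp: field_simps)
  moreover have "(1 / ?a) powr \<mu> = 3 / c"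
    using c \<mu> by (simp add: powr_divide powr_powr)
  ultimately have "3 * \<Psi> u \<le> \<Psi> (u / ?a)" using c by simp
  then have "s * (3 * \<Psi> u) \<le> s * \<Psi> (u / ?a)" using s0 by (rule mult_left_mono)
  moreover have "1 \<le> s * \<Psi> u" "s * \<Psi> u \<le> 2" using s u by (simp_all add: field_simps)
  ultimately have "exp (1 - s * \<Psi> (u / ?a)) \<le> exp (- 2)" by simp
  also have "exp (- 2 :: real) \<le> 1 / 4"
  proof -
    have "(2::real) * 2 \<le> exp 1 * exp 1"
      using exp_ge_add_one_self[of "1::real"] by (intro mult_mono) auto
    then show ?thesis by (simp add: exp_minus field_simps flip: exp_add)
  qed
  finally have 1: "prob {\<omega> \<in> space M. S s \<omega> \<le> ?a / u} \<le> 1 / 4"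
    using prob_S_le[OF s0, of "u / ?a"] u a by simp
  have "c * ?b powr \<mu> * \<Psi> (u / ?b) \<le> \<Psi> (?b * (u / ?b))"
    using b u by (intro scaling) (auto simp: divide_pos_pos)
  moreover have "?b powr \<mu> = 16 / c"
    using c \<mu> by (simp add: powr_powr)
  ultimately have "16 * \<Psi> (u / ?b) \<le> \<Psi> u" using c b by simp
  then have "s * (16 * \<Psi> (u / ?b)) \<le> s * \<Psi> u" using s0 by (rule mult_left_mono)
  with \<open>s * \<Psi> u \<le> 2\<close> have "2 * (s * \<Psi> (u / ?b)) \<le> 1 / 4" by simp
  then have 2: "prob {\<omega> \<in> space M. ?b / u < S s \<omega>} \<le> 1 / 4"
    using prob_S_gt[OF s0, of "u / ?b"] u b by simp
  have "1 = prob (space M)" by (simp add: prob_space)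
  also have "space M = {\<omega> \<in> space M. S s \<omega> \<le> ?a / u} \<union> {\<omega> \<in> space M. ?b / u < S s \<omega>}
      \<union> {\<omega> \<in> space M. S s \<omega> \<in> {?a / u<..?b / u}}" by auto
  also have "prob \<dots> \<le> prob ({\<omega> \<in> space M. S s \<omega> \<le> ?a / u} \<union> {\<omega> \<in> space M. ?b / u < S s \<omega>})
     + prob {\<omega> \<in> space M. S s \<omega> \<in> {?a / u<..?b / u}}"
    by (rule measure_Un_le) measurable
  also have "prob ({\<omega> \<in> space M. S s \<omega> \<le> ?a / u} \<union> {\<omega> \<in> space M. ?b / u < S s \<omega>}) \<le> 1 / 4 + 1 / 4"
    using 1 2 by (intro order_trans[OF measure_Un_le] add_mono) measurable
  finally show ?thesis by simp
qed

section \<open>Potential estimates for super-solutions\<close>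

text \<open>The stopped time need not be measurable. It equals \<open>t\<close> on each of the measurable events \<open>A n\<close>,
  which increase to an event of probability one.\<close>

lemma super_solution_imp_potential_le:
  assumes sup: "super_solution M Y p \<phi>" and Y: "AE \<omega> in M. \<forall>t\<ge>0. Y t \<omega> = X t \<omega>" and t: "0 < t"
  shows "(\<integral>\<^sup>+s. (\<integral>\<^sup>+\<omega>. ennreal (\<phi> (x + X s \<omega>) powr p) \<partial>M) * indicator {0..t} s \<partial>lborel) \<le> ennreal (\<phi> x)"
proof -
  have [measurable]: "\<phi> \<in> borel_measurable borel"
    using sup by (auto simp: super_solution_def intro: borel_measurable_continuous_onI)
  obtain N where N: "{\<omega> \<in> space M. \<not> (\<forall>t\<ge>0. Y t \<omega> = X t \<omega>)} \<subseteq> N" "N \<in> null_sets M"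
    using Y by (auto elim!: AE_E simp: null_sets_def)
  have [measurable]: "N \<in> sets M" using N by auto
  \<comment> \<open>Testing only rational times makes the event measurable. The margins -1 and +1
    around the range of \<open>S\<close> on [0, t] ensure that every value there has a neighbourhood
    within the tested times.\<close>
  define A where "A n = {\<omega> \<in> space M. \<forall>q. - 1 \<le> real_of_rat q \<longrightarrow> real_of_rat q \<le> S t \<omega> + 1 \<longrightarrow>
      norm (B (real_of_rat q) \<omega>) \<le> real n} - N" for n
  have [measurable]: "A n \<in> sets M" for n unfolding A_def by measurable
  have A: "norm (X s \<omega>) \<le> real n" "Y s \<omega> = X s \<omega>" if "\<omega> \<in> A n" "0 \<le> s" "s \<le> t" for n s \<omega>
  proof -
    have \<omega>: "\<omega> \<in> space M" "\<omega> \<notin> N" using that by (auto simp: A_def)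
    show "Y s \<omega> = X s \<omega>" using N \<omega> that by blast
    \<comment> \<open>If the bound failed at time \<open>S s\<close>, continuity of \<open>B\<close>
      would make it fail on an open set, hence at a rational time.\<close>
    define U where "U = {-1<..<S t \<omega> + 1} \<inter> (\<lambda>v. norm (B v \<omega>)) -` {real n<..}"
    have "open U" unfolding U_def
      using continuous_on_norm[OF continuous_B[OF \<omega>(1)]]
      by (intro open_Int open_greaterThanLessThan open_vimage) auto
    show "norm (X s \<omega>) \<le> real n"
    proof (rule ccontr)
      assume "\<not> norm (X s \<omega>) \<le> real n"
      then have "S s \<omega> \<in> U"
        using nonneg_S[OF \<omega>(1), of s] mono_S[OF \<omega>(1) that(3)] by (auto simp: U_def X_def)
      with \<open>open U\<close> obtain e where e: "e > 0" "ball (S s \<omega>) e \<subseteq> U"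
        by (auto simp: open_contains_ball)
      obtain q where q: "S s \<omega> < real_of_rat q" "real_of_rat q < S s \<omega> + e"
        using of_rat_dense[of "S s \<omega>" "S s \<omega> + e"] e by auto
      then have "real_of_rat q \<in> U" using e by (auto simp: dist_real_def)
      then have "- 1 \<le> real_of_rat q" "real_of_rat q \<le> S t \<omega> + 1" "\<not> norm (B (real_of_rat q) \<omega>) \<le> real n"
        by (auto simp: U_def)
      then show False using that(1) unfolding A_def by blast
    qed
  qed
  \<comment> \<open>The radius n + 1 exceeds the bound n strictly, so the path stays in the open
    ball up to time \<open>t\<close> and cannot exit before \<open>t\<close>.\<close>
  have stop: "stopped_time Y x (real n + 1) t \<omega> = t" if "\<omega> \<in> A n" for n \<omega>
  proof -
    have "ereal t \<le> exit_time (\<lambda>s. x + Y s \<omega>) (ball x (real n + 1))"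
      unfolding exit_time_def
    proof (rule INF_greatest)
      fix s assume s: "s \<in> {s. 0 < s \<and> x + Y s \<omega> \<notin> ball x (real n + 1)}"
      show "ereal t \<le> ereal s"
      proof (rule ccontr)
        assume "\<not> ereal t \<le> ereal s"
        then have "norm (Y s \<omega>) \<le> real n" using A[OF that, of s] s by auto
        with s show False by (auto simp: dist_norm)
      qed
    qed
    then show ?thesis by (simp add: stopped_time_def min_def)
  qed
  define h where "h \<omega> = (\<integral>\<^sup>+s. ennreal (\<phi> (x + X s \<omega>) powr p) * indicator {0..t} s \<partial>lborel)" for \<omega>
  have [measurable]: "(\<lambda>(\<omega>, s). ennreal (\<phi> (x + X s \<omega>) powr p) * indicator {0..t} s) \<in> borel_measurable (M \<Otimes>\<^sub>M lborel)"
  proof -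
    have "(\<lambda>p. X (fst p) (snd p)) \<circ> (\<lambda>(\<omega>, s). (s, \<omega>)) \<in> borel_measurable (M \<Otimes>\<^sub>M lborel)"
      by (rule measurable_comp[where N = "borel \<Otimes>\<^sub>M M"]) measurable
    then have [measurable]: "(\<lambda>(\<omega>, s). X s \<omega>) \<in> borel_measurable (M \<Otimes>\<^sub>M lborel)"
      by (simp add: comp_def split_beta')
    show ?thesis by measurable
  qed
  have [measurable]: "h \<in> borel_measurable M" unfolding h_def by measurable
  have le: "emeasure (density M h) (A n) \<le> ennreal (\<phi> x)" for n
  proof -
    have "emeasure (density M h) (A n) = (\<integral>\<^sup>+\<omega>. h \<omega> * indicator (A n) \<omega> \<partial>M)"
      by (simp add: emeasure_density)
    also have "\<dots> \<le> (\<integral>\<^sup>+\<omega>. (\<integral>\<^sup>+s\<in>{0..stopped_time Y x (real n + 1) t \<omega>}.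
              ennreal (\<phi> (x + Y s \<omega>) powr p) \<partial>lborel) \<partial>M)"
    \<comment> \<open>Off \<open>A n\<close> the left-hand side is 0, and on it the stopped time is
      \<open>t\<close>. Monotonicity of \<open>nn_integral\<close> does not ask for measurability of
      the larger integrand.\<close>
    proof (rule nn_integral_mono)
      fix \<omega>
      show "h \<omega> * indicator (A n) \<omega> \<le> (\<integral>\<^sup>+s\<in>{0..stopped_time Y x (real n + 1) t \<omega>}.
              ennreal (\<phi> (x + Y s \<omega>) powr p) \<partial>lborel)"
        by (cases "\<omega> \<in> A n")
          (auto simp: stop h_def A intro!: nn_integral_mono split: split_indicator)
    qed
    also have "\<dots> \<le> ennreal (\<phi> x)"
    proof -
      have "(\<integral>\<^sup>+\<omega>. ennreal (\<phi> (x + Y (stopped_time Y x (real n + 1) t \<omega>) \<omega>)) \<partial>M) +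
          (\<integral>\<^sup>+\<omega>. (\<integral>\<^sup>+s\<in>{0..stopped_time Y x (real n + 1) t \<omega>}.
              ennreal (\<phi> (x + Y s \<omega>) powr p) \<partial>lborel) \<partial>M) \<le> ennreal (\<phi> x)"
        using sup t by (simp add: super_solution_def)
      then show ?thesis by (meson add_increasing order_trans zero_le le_add_same_cancel2 order_refl)
    qed
    finally show ?thesis .
  qed
  have "incseq A" by (rule incseq_SucI) (force simp: A_def)
  \<comment> \<open>Outside \<open>N\<close>, each path of \<open>B\<close> is bounded on the
    compact interval of tested times, so some \<open>n\<close> works.\<close>
  have UN: "(\<Union>n. A n) = space M - N"
  proof (intro equalityI subsetI)
    fix \<omega> assume \<omega>: "\<omega> \<in> space M - N"
    then have "continuous_on {-1..S t \<omega> + 1} (\<lambda>v. B v \<omega>)"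
      by (intro continuous_on_subset[OF continuous_B]) auto
    then have "bounded ((\<lambda>v. B v \<omega>) ` {-1..S t \<omega> + 1})"
      by (intro compact_imp_bounded compact_continuous_image) auto
    then obtain K where K: "\<And>v. v \<in> {-1..S t \<omega> + 1} \<Longrightarrow> norm (B v \<omega>) \<le> K"
      unfolding bounded_iff by blast
    obtain n where "K \<le> real n" using real_arch_simple by blast
    then have "\<omega> \<in> A n" using \<omega> K by (force simp: A_def)
    then show "\<omega> \<in> (\<Union>n. A n)" by blast
  qed (auto simp: A_def)
  interpret P: pair_sigma_finite M "lborel :: real measure" by standard
  have "(\<integral>\<^sup>+s. (\<integral>\<^sup>+\<omega>. ennreal (\<phi> (x + X s \<omega>) powr p) \<partial>M) * indicator {0..t} s \<partial>lborel)
    = (\<integral>\<^sup>+s. (\<integral>\<^sup>+\<omega>. ennreal (\<phi> (x + X s \<omega>) powr p) * indicator {0..t} s \<partial>M) \<partial>lborel)"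
    by (simp add: nn_integral_multc)
  also have "\<dots> = (\<integral>\<^sup>+\<omega>. h \<omega> \<partial>M)"
    unfolding h_def by (rule P.Fubini') measurable
  also have "\<dots> = (\<integral>\<^sup>+\<omega>. h \<omega> * indicator (space M - N) \<omega> \<partial>M)"
  proof (rule nn_integral_cong_AE)
    show "AE \<omega> in M. h \<omega> = h \<omega> * indicator (space M - N) \<omega>"
      using AE_not_in[OF N(2)] AE_space by eventually_elim simp
  qed
  also have "\<dots> = emeasure (density M h) (\<Union>n. A n)"
    unfolding UN by (simp add: emeasure_density)
  also have "\<dots> = (SUP n. emeasure (density M h) (A n))"
    by (rule SUP_emeasure_incseq[symmetric]) (auto simp: \<open>incseq A\<close>)
  also have "\<dots> \<le> ennreal (\<phi> x)"
    by (rule SUP_least) (rule le)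
  finally show ?thesis .
qed

text \<open>With u = 1 / R^2, the value of \<phi> at \<open>x\<close> dominates the potential over
  the time window from 1 / \<Psi> u to 2 / \<Psi> u, of length 1 / \<Psi> u. At each such time,
  \<open>S\<close> lies between a R^2 and b R^2 with probability at least 1/2, and there the
  Gaussian density is at least \<kappa> R^(-d) at differences of points of the ball.\<close>

lemma super_solution_ge_ball:
  assumes sup: "super_solution M Y p \<phi>" and Y: "AE \<omega> in M. \<forall>t\<ge>0. Y t \<omega> = X t \<omega>" and p: "0 < p"
    and c: "0 < c" "c \<le> 1" and \<mu>: "0 < \<mu>"
    and scaling: "\<And>u \<gamma>. 0 < u \<Longrightarrow> 1 \<le> \<gamma> \<Longrightarrow> c * \<gamma> powr \<mu> * \<Psi> u \<le> \<Psi> (\<gamma> * u)"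
    and pos: "\<And>u. 0 < u \<Longrightarrow> 0 < \<Psi> u"
    and R: "1 \<le> R" and x: "x \<in> ball 0 R"
  defines "a \<equiv> (c / 3) powr (1 / \<mu>)" and "b \<equiv> (16 / c) powr (1 / \<mu>)"
  defines "\<kappa> \<equiv> (4 * pi * (b + 1)) powr (- real DIM('a) / 2) * exp (- 1 / a)"
  shows "ennreal (\<kappa> / 2 * R powr (- real DIM('a)) / \<Psi> (1 / R\<^sup>2))
           * (\<integral>\<^sup>+y\<in>ball 0 R. ennreal (\<phi> y powr p) \<partial>lborel) \<le> ennreal (\<phi> x)"
proof -
  have \<phi>: "continuous_on UNIV \<phi>" "\<And>x. 0 \<le> \<phi> x"
    using sup by (auto simp: super_solution_def)
  have \<phi>p: "continuous_on A (\<lambda>z. \<phi> (x + z) powr p)" for A x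
    using \<phi> p by (intro continuous_on_powr' continuous_on_compose2[OF \<phi>(1)] continuous_intros) auto
  have [measurable]: "\<phi> \<in> borel_measurable borel"
    using \<phi>(1) by (rule borel_measurable_continuous_onI)
  have [measurable]: "ball (0::'a) r \<in> sets borel" for r
    by simp
  have "bounded ((\<lambda>z. \<phi> (0 + z) powr p) ` cball 0 R)"
    by (intro compact_imp_bounded compact_continuous_image \<phi>p compact_cball)
  then obtain K where K: "\<And>z. z \<in> cball 0 R \<Longrightarrow> norm (\<phi> (0 + z) powr p) \<le> K"
    unfolding bounded_iff by blast
  \<comment> \<open>The estimates for \<open>B\<close> and \<open>X\<close> require bounded
    functions. Since \<open>K\<close> bounds the p-th power of \<phi> on the closed ball, the
    truncation changes nothing where x + z lies in the ball.\<close>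
  define f where "f z = min (\<phi> (x + z) powr p) K" for z
  have K0: "0 \<le> K" using order_trans[OF norm_ge_zero K[of 0]] R by simp
  have f: "continuous_on UNIV f" "\<And>z. 0 \<le> f z" "\<And>z. f z \<le> K"
    using K0 by (auto simp: f_def intro!: continuous_on_min \<phi>p)
  define I where "I = (\<integral>\<^sup>+y\<in>ball 0 R. ennreal (\<phi> y powr p) \<partial>lborel)"
  define u where "u = 1 / R\<^sup>2"
  have u: "0 < u" using R by (simp add: u_def)
  have a: "0 < a" using c by (simp add: a_def)
  have b: "0 < b" using c by (simp add: b_def)
  have \<kappa>: "0 < \<kappa>" using b by (simp add: \<kappa>_def)
  let ?m = "ennreal (\<kappa> * R powr (- real DIM('a))) * I"
  have B: "?m \<le> (\<integral>\<^sup>+\<omega>. ennreal (f (B q \<omega>)) \<partial>M)" if q: "a / u \<le> q" "q \<le> b / u + 1" for q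
  proof -
    have "0 < a / u" using a u by simp
    with q have q0: "0 < q" by linarith
    have "?m = (\<integral>\<^sup>+y. ennreal (\<kappa> * R powr (- real DIM('a))) * (ennreal (\<phi> y powr p) * indicator (ball 0 R) y) \<partial>lborel)"
      by (subst nn_integral_cmult) (simp_all add: I_def)
    also have "\<dots> = (\<integral>\<^sup>+y. ennreal (\<kappa> * R powr (- real DIM('a))) * (ennreal (\<phi> y powr p) * indicator (ball 0 R) y) \<partial>distr lborel borel ((+) x))"
      by (simp only: lborel_distr_plus)
    also have "\<dots> = (\<integral>\<^sup>+z. ennreal (\<kappa> * R powr (- real DIM('a))) * (ennreal (\<phi> (x + z) powr p) * indicator (ball 0 R) (x + z)) \<partial>lborel)"
      by (subst nn_integral_distr) auto
    also have "\<dots> \<le> (\<integral>\<^sup>+z. ennreal (f z) * ennreal (heat_kernel q z) \<partial>lborel)"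
    proof (intro nn_integral_mono)
      fix z :: 'a
      show "ennreal (\<kappa> * R powr (- real DIM('a))) * (ennreal (\<phi> (x + z) powr p) * indicator (ball 0 R) (x + z))
        \<le> ennreal (f z) * ennreal (heat_kernel q z)"
      proof (cases "x + z \<in> ball 0 R")
        case True
        have "norm z \<le> norm (x + z) + norm x"
          using norm_triangle_ineq4[of "x + z" x] by simp
        then have "norm z \<le> 2 * R" using True x by simp
        moreover have "a * R\<^sup>2 \<le> q" "q \<le> b * R\<^sup>2 + 1" using q by (simp_all add: u_def)
        ultimately have "\<kappa> * R powr (- real DIM('a)) \<le> heat_kernel q z"
          unfolding \<kappa>_def using a b R by (intro heat_kernel_lower_bound) auto
        moreover have "f z = \<phi> (x + z) powr p"
          using K[of "x + z"] True by (simp add: f_def)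
        ultimately show ?thesis using True
          by (subst mult.commute) (simp add: mult_left_mono ennreal_leI)
      qed simp
    qed
    also have "\<dots> \<le> (\<integral>\<^sup>+\<omega>. ennreal (f (B q \<omega>)) \<partial>M)"
      using q0 by (intro nn_integral_heat_kernel_le[where K = K] f measurable_B char_B) auto
    finally show ?thesis .
  qed
  have X: "?m * ennreal (1 / 2) \<le> (\<integral>\<^sup>+\<omega>. ennreal (\<phi> (x + X s \<omega>) powr p) \<partial>M)"
    if s: "1 / \<Psi> u \<le> s" "s \<le> 2 / \<Psi> u" for s
  proof -
    have s0: "0 \<le> s" using s(1) pos[OF u] by (meson divide_nonneg_pos order_trans zero_le_one)
    have "?m * ennreal (1 / 2) \<le> ?m * emeasure M {\<omega> \<in> space M. S s \<omega> \<in> {a / u<..b / u}}"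
      unfolding emeasure_eq_measure a_def b_def
      by (intro mult_left_mono ennreal_leI prob_S_interval c \<mu> scaling u pos s) auto
    also have "\<dots> \<le> (\<integral>\<^sup>+\<omega>. ennreal (f (X s \<omega>)) \<partial>M)"
      using a u by (intro nn_integral_X_ge[OF s0 _ f] B) auto
    also have "\<dots> \<le> (\<integral>\<^sup>+\<omega>. ennreal (\<phi> (x + X s \<omega>) powr p) \<partial>M)"
      by (intro nn_integral_mono ennreal_leI) (simp add: f_def)
    finally show ?thesis .
  qed
  have \<Psi>u: "0 < \<Psi> u" using u by (rule pos)
  have "ennreal (\<kappa> / 2 * R powr (- real DIM('a)) / \<Psi> u) * I = ?m * ennreal (1 / 2) * ennreal (1 / \<Psi> u)"
  proof -
    have "ennreal (\<kappa> / 2 * R powr (- real DIM('a)) / \<Psi> u)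
       = ennreal (\<kappa> * R powr (- real DIM('a)) * (1 / 2) * (1 / \<Psi> u))" by simp
    also have "\<dots> = ennreal (\<kappa> * R powr (- real DIM('a))) * ennreal (1 / 2) * ennreal (1 / \<Psi> u)"
      using \<kappa> \<Psi>u by (subst ennreal_mult, simp, simp, subst ennreal_mult, simp_all)
    finally show ?thesis by (simp only: mult_ac)
  qed
  also have "\<dots> = (\<integral>\<^sup>+s. ?m * ennreal (1 / 2) * indicator {1 / \<Psi> u..2 / \<Psi> u} s \<partial>lborel)"
    using \<Psi>u by (subst nn_integral_cmult) (simp_all add: divide_right_mono flip: diff_divide_distrib)
  also have "\<dots> \<le> (\<integral>\<^sup>+s. (\<integral>\<^sup>+\<omega>. ennreal (\<phi> (x + X s \<omega>) powr p) \<partial>M) * indicator {0..2 / \<Psi> u} s \<partial>lborel)"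
  proof (intro nn_integral_mono)
    fix s
    have "0 \<le> s" if "1 / \<Psi> u \<le> s" using that \<Psi>u by (meson divide_nonneg_pos order_trans zero_le_one)
    then show "?m * ennreal (1 / 2) * indicator {1 / \<Psi> u..2 / \<Psi> u} s
      \<le> (\<integral>\<^sup>+\<omega>. ennreal (\<phi> (x + X s \<omega>) powr p) \<partial>M) * indicator {0..2 / \<Psi> u} s"
      using X[of s] by (auto split: split_indicator)
  qed
  also have "\<dots> \<le> ennreal (\<phi> x)"
    using \<Psi>u by (intro super_solution_imp_potential_le[OF sup Y]) simp
  finally show ?thesis by (simp only: I_def u_def)
qed

text \<open>Subcriticality makes the exponent \<delta> positive, so the inequality
  \<open>key\<close> cannot hold for all large R while the mass \<open>I R0\<close> is
  positive.\<close>

lemma no_super_solution: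
  assumes sup: "super_solution M Y p \<phi>" and Y: "AE \<omega> in M. \<forall>t\<ge>0. Y t \<omega> = X t \<omega>" and p: "1 < p"
    and c: "0 < c" "c \<le> 1" and \<mu>: "0 < \<mu>"
    and scaling: "\<And>u \<gamma>. 0 < u \<Longrightarrow> 1 \<le> \<gamma> \<Longrightarrow> c * \<gamma> powr \<mu> * \<Psi> u \<le> \<Psi> (\<gamma> * u)"
    and pos: "\<And>u. 0 < u \<Longrightarrow> 0 < \<Psi> u"
    and subcritical: "p * (real DIM('a) - 2 * \<mu>) < real DIM('a)"
  shows "\<phi> x0 = 0"
proof (rule ccontr)
  assume "\<phi> x0 \<noteq> 0"
  let ?d = "real DIM('a)"
  have \<phi>: "continuous_on UNIV \<phi>" "\<And>x. 0 \<le> \<phi> x"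
    using sup by (auto simp: super_solution_def)
  have \<phi>p: "continuous_on A (\<lambda>z. \<phi> z powr p)" for A
    using \<phi> p by (intro continuous_on_powr' continuous_on_subset[OF \<phi>(1)] continuous_intros) auto
  have [measurable]: "\<phi> \<in> borel_measurable borel"
    using \<phi>(1) by (rule borel_measurable_continuous_onI)
  have [measurable]: "ball (0::'a) r \<in> sets borel" for r
    by simp
  define I where "I R = (LINT y:ball 0 R|lborel. \<phi> y powr p)" for R
  \<comment> \<open>Continuity gives local integrability, which makes \<open>I R\<close> a finite
    real number that can be cancelled below.\<close>
  have int: "set_integrable lborel (ball 0 R) (\<lambda>y. \<phi> y powr p)" for R
  proof (rule set_integrable_subset)
    show "set_integrable lborel (cball 0 R) (\<lambda>y. \<phi> y powr p)"
      unfolding set_integrable_def by (intro borel_integrable_compact \<phi>p) simp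
  qed auto
  have I: "(\<integral>\<^sup>+y\<in>ball 0 R. ennreal (\<phi> y powr p) \<partial>lborel) = ennreal (I R)" for R
  proof -
    have "(\<integral>\<^sup>+y\<in>ball 0 R. ennreal (\<phi> y powr p) \<partial>lborel) = (\<integral>\<^sup>+y. ennreal (indicator (ball 0 R) y *\<^sub>R \<phi> y powr p) \<partial>lborel)"
      by (intro nn_integral_cong) (simp split: split_indicator)
    also have "\<dots> = ennreal (I R)"
      unfolding I_def set_lebesgue_integral_def
      by (intro nn_integral_eq_integral int[unfolded set_integrable_def]) auto
    finally show ?thesis .
  qed
  have I_nonneg: "0 \<le> I R" for R
    unfolding I_def set_lebesgue_integral_def by simp
  have I_mono: "I R \<le> I R'" if "R \<le> R'" for R R'
  proof -
    have "ennreal (I R) \<le> ennreal (I R')"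
      unfolding I[symmetric] using that by (intro nn_integral_mono) (auto split: split_indicator)
    then show ?thesis using I_nonneg by (simp add: ennreal_le_iff)
  qed
  define R0 where "R0 = norm x0 + 1"
  \<comment> \<open>A continuous function that is nonzero at \<open>x0\<close> is nonzero on a
    nonempty open set, which is not a null set; \<open>R0\<close> is large enough for the ball to
    contain \<open>x0\<close>.\<close>
  have I0: "0 < I R0"
  proof (rule ccontr)
    assume "\<not> 0 < I R0"
    then have "(\<integral>\<^sup>+y\<in>ball 0 R0. ennreal (\<phi> y powr p) \<partial>lborel) = 0"
      using I_nonneg[of R0] I[of R0] by simp
    then have "AE y in lborel. ennreal (\<phi> y powr p) * indicator (ball 0 R0) y = 0"
      by (subst (asm) nn_integral_0_iff_AE) auto
    then have ae: "AE y in lborel. y \<in> ball 0 R0 \<longrightarrow> \<phi> y = 0"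
      by eventually_elim (auto split: split_indicator_asm)
    define U where "U = ball 0 R0 \<inter> \<phi> -` (- {0})"
    have U: "open U" unfolding U_def
      by (intro open_Int open_ball open_vimage \<phi>(1)) auto
    have "AE y in lborel. y \<notin> U" using ae by eventually_elim (auto simp: U_def)
    then have "U \<in> null_sets lborel"
      using U by (subst (asm) AE_iff_null_sets[symmetric]) auto
    moreover have "x0 \<in> U" using \<open>\<phi> x0 \<noteq> 0\<close> by (simp add: U_def R0_def)
    ultimately show False
      using U open_not_negligible[of U] by (auto simp: negligible_iff_null_sets null_sets_completionI)
  qed
  define a where "a = (c / 3) powr (1 / \<mu>)"
  define b where "b = (16 / c) powr (1 / \<mu>)"
  define \<kappa> where "\<kappa> = (4 * pi * (b + 1)) powr (- ?d / 2) * exp (- 1 / a)"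
  have "0 < b" using c by (simp add: b_def)
  then have \<kappa>: "0 < \<kappa>" by (simp add: \<kappa>_def)
  define C where "C = \<kappa> / 2 * (c / \<Psi> 1)"
  have C: "0 < C" using \<kappa> c pos[of 1] by (simp add: C_def)
  define v where "v = unit_ball_vol ?d"
  have v: "0 < v" by (simp add: v_def)
  define \<delta> where "\<delta> = ?d + (2 * \<mu> - ?d) * p"
  have \<delta>: "0 < \<delta>" using subcritical by (simp add: \<delta>_def algebra_simps)
  have key: "v * C powr p * I R0 powr (p - 1) * R powr \<delta> \<le> 1" if R: "1 \<le> R" "R0 \<le> R" for R
  proof -
    have IR: "0 < I R" using I0 I_mono[OF R(2)] by simp
    have R0: "0 < R" using R by simp
    \<comment> \<open>Lower scaling from 1 / R^2 up to 1 bounds 1 / \<Psi>(1 / R^2) from below by a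
      multiple of R^(2 \<mu>).\<close>
    have "c * (R\<^sup>2) powr \<mu> * \<Psi> (1 / R\<^sup>2) \<le> \<Psi> (R\<^sup>2 * (1 / R\<^sup>2))"
      using R by (intro scaling) auto
    also have "(R\<^sup>2) powr \<mu> = (R powr 2) powr \<mu>" using R0 by simp
    also have "\<dots> = R powr (2 * \<mu>)" by (rule powr_powr)
    finally have "c * R powr (2 * \<mu>) / \<Psi> 1 \<le> 1 / \<Psi> (1 / R\<^sup>2)"
      using R0 pos[of 1] pos[of "1 / R\<^sup>2"] by (simp add: field_simps)
    then have "\<kappa> / 2 * R powr (- ?d) * (c * R powr (2 * \<mu>) / \<Psi> 1) \<le> \<kappa> / 2 * R powr (- ?d) * (1 / \<Psi> (1 / R\<^sup>2))"
      using \<kappa> by (intro mult_left_mono) auto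
    moreover have "R powr (2 * \<mu> - ?d) = R powr (- ?d) * R powr (2 * \<mu>)"
      by (simp flip: powr_add)
    then have "\<kappa> / 2 * R powr (- ?d) * (c * R powr (2 * \<mu>) / \<Psi> 1) = C * R powr (2 * \<mu> - ?d)"
      by (simp add: C_def)
    ultimately have C_le: "C * R powr (2 * \<mu> - ?d) \<le> \<kappa> / 2 * R powr (- ?d) / \<Psi> (1 / R\<^sup>2)" by simp
    have ptw: "(C * R powr (2 * \<mu> - ?d) * I R) powr p \<le> \<phi> x powr p" if x: "x \<in> ball 0 R" for x
    proof -
      have "ennreal (C * R powr (2 * \<mu> - ?d) * I R) = ennreal (C * R powr (2 * \<mu> - ?d)) * ennreal (I R)"
        using C I_nonneg by (intro ennreal_mult) auto
      also have "\<dots> \<le> ennreal (\<kappa> / 2 * R powr (- ?d) / \<Psi> (1 / R\<^sup>2)) * ennreal (I R)"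
        by (intro mult_right_mono ennreal_leI C_le) auto
      also have "\<dots> \<le> ennreal (\<phi> x)"
        unfolding I[symmetric] \<kappa>_def a_def b_def
        by (rule super_solution_ge_ball[OF sup Y _ c \<mu> scaling pos R(1) x]) (use p in auto)
      finally have "C * R powr (2 * \<mu> - ?d) * I R \<le> \<phi> x"
        using \<phi> by (simp add: ennreal_le_iff)
      then show ?thesis
        using C I_nonneg p by (intro powr_mono2) auto
    qed
    have "v * R powr ?d * (C * R powr (2 * \<mu> - ?d) * I R) powr p
       = (LINT y:ball (0::'a) R|lborel. (C * R powr (2 * \<mu> - ?d) * I R) powr p)"
      using R0 by (subst set_integral_const) (simp_all add: emeasure_ball content_ball v_def powr_realpow)
    also have "\<dots> \<le> I R"
    proof -
      have "set_integrable lborel (cball (0::'a) R) (\<lambda>_. (C * R powr (2 * \<mu> - ?d) * I R) powr p)"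
        unfolding set_integrable_def by (intro borel_integrable_compact) auto
      then have "set_integrable lborel (ball (0::'a) R) (\<lambda>_. (C * R powr (2 * \<mu> - ?d) * I R) powr p)"
        by (rule set_integrable_subset) auto
      from set_integral_mono[OF this int ptw] show ?thesis by (simp only: I_def)
    qed
    finally have "v * R powr ?d * (C * R powr (2 * \<mu> - ?d) * I R) powr p \<le> I R" .
    moreover have "v * R powr ?d * (C * R powr (2 * \<mu> - ?d) * I R) powr p
       = (v * C powr p * R powr \<delta> * I R powr (p - 1)) * I R"
    proof -
      have "I R powr p = I R powr (p - 1) * I R powr 1"
        by (simp only: powr_add[symmetric] diff_add_cancel)
      then have "(C * R powr (2 * \<mu> - ?d) * I R) powr p = C powr p * R powr ((2 * \<mu> - ?d) * p) * (I R powr (p - 1) * I R)"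
        using IR by (simp add: powr_mult powr_powr)
      moreover have "R powr \<delta> = R powr ?d * R powr ((2 * \<mu> - ?d) * p)"
        by (simp add: \<delta>_def powr_add)
      ultimately show ?thesis by (simp only: mult_ac)
    qed
    ultimately have "(v * C powr p * R powr \<delta> * I R powr (p - 1)) * I R \<le> 1 * I R"
      by simp
    then have "v * C powr p * R powr \<delta> * I R powr (p - 1) \<le> 1"
      using IR by (simp only: mult_le_cancel_right_pos)
    \<comment> \<open>Passing to the fixed radius \<open>R0\<close> makes the constant independent
      of \<open>R\<close>; p > 1 keeps the power increasing in the mass.\<close>
    moreover have "v * C powr p * R powr \<delta> * I R0 powr (p - 1) \<le> v * C powr p * R powr \<delta> * I R powr (p - 1)"
      using v I0 I_mono[OF R(2)] p by (intro mult_left_mono powr_mono2) auto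
    ultimately show ?thesis by (simp add: mult_ac)
  qed
  have "0 < v * C powr p * I R0 powr (p - 1)" using v C I0 by simp
  then obtain A where A: "A = v * C powr p * I R0 powr (p - 1)" "0 < A" by blast
  \<comment> \<open>Large enough that A R^\<delta> \<ge> 2, against the bound 1 from
    \<open>key\<close>.\<close>
  define R where "R = max (max 1 R0) ((2 / A) powr (1 / \<delta>))"
  have "2 / A = ((2 / A) powr (1 / \<delta>)) powr \<delta>"
    using A \<delta> by (simp add: powr_powr)
  also have "\<dots> \<le> R powr \<delta>"
    using \<delta> by (intro powr_mono2) (auto simp: R_def)
  finally have "2 \<le> A * R powr \<delta>"
    using A by (simp add: field_simps)
  moreover have "A * R powr \<delta> \<le> 1"
    unfolding A(1) by (rule key) (simp_all add: R_def le_max_iff_disj)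
  ultimately show False by simp
qed

section \<open>Positivity of the Laplace exponent\<close>

text \<open>At a zero of the exponent, 1 - exp (- u S) has expectation 0, so each \<open>S t\<close>
  vanishes almost surely. At all natural-number times simultaneously the process then sits at
  \<open>B 0\<close> and does not tend to infinity. Countably many times keep the exceptional set
  null.\<close>

lemma transient_imp_exponent_nonzero:
  assumes tr: "transient M Y" and Y: "AE \<omega> in M. \<forall>t\<ge>0. Y t \<omega> = X t \<omega>" and u: "0 < u"
  shows "\<Psi> u \<noteq> 0"
proof
  assume 0: "\<Psi> u = 0"
  have S: "AE \<omega> in M. S t \<omega> = 0" if t: "0 \<le> t" for t
  proof -
    have "(LINT \<omega>|M. 1 - exp (- u * S t \<omega>)) = 0"
      using integrable_exp_S[OF u, of t] laplace_S[OF t u] 0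
      by (subst Bochner_Integration.integral_diff) (simp_all add: prob_space)
    moreover have "integrable M (\<lambda>\<omega>. 1 - exp (- u * S t \<omega>))"
      by (intro Bochner_Integration.integrable_diff integrable_exp_S u) simp
    moreover have "AE \<omega> in M. 0 \<le> 1 - exp (- u * S t \<omega>)"
      using u nonneg_S by (intro AE_I2) simp
    ultimately have "AE \<omega> in M. 1 - exp (- u * S t \<omega>) = 0"
      using integral_nonneg_eq_0_iff_AE by blast
    then show ?thesis by eventually_elim (use u in simp)
  qed
  have "AE \<omega> in M. \<forall>n. S (real n) \<omega> = 0"
    by (subst AE_all_countable) (simp add: S)
  moreover have "AE \<omega> in M. filterlim (\<lambda>t. norm (Y t \<omega>)) at_top at_top"
    using tr by (simp add: transient_def)
  ultimately have "AE \<omega> in M. False"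
    using Y
  proof eventually_elim
    case (elim \<omega>)
    have "filterlim (\<lambda>n. norm (Y (real n) \<omega>)) at_top sequentially"
      by (rule filterlim_compose[OF elim(2) filterlim_real_sequentially])
    also have "(\<lambda>n. norm (Y (real n) \<omega>)) = (\<lambda>_. norm (B 0 \<omega>))"
      using elim(1,3) by (auto simp: X_def)
    finally show False
      by (metis filterlim_at_top_imp_at_infinity not_tendsto_and_filterlim_at_infinity sequentially_bot tendsto_const)
  qed
  then show False by simp
qed

end

section \<open>A regular version of the pair of processes\<close>

text \<open>Transfers independence of the two generated sigma-algebras to events about single
  times.\<close>

lemma restrict_process_preimage_in_vimage_algebra:
  fixes Z :: "real \<Rightarrow> 'w \<Rightarrow> 'b::topological_space"
  assumes "0 \<le> t" "A \<in> sets borel"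
  shows "{\<omega> \<in> \<Omega>. Z t \<omega> \<in> A} \<in> sets (vimage_algebra \<Omega> (\<lambda>\<omega>. \<lambda>t\<in>{0..}. Z t \<omega>) (\<Pi>\<^sub>M t\<in>{0..}. borel))"
proof -
  let ?Z = "\<lambda>\<omega>. \<lambda>t\<in>{0..}. Z t \<omega>" and ?P = "\<Pi>\<^sub>M t\<in>{0::real..}. (borel :: 'b measure)"
  have "(\<lambda>g. g t) -` A \<inter> space ?P \<in> sets ?P"
    using assms by (intro measurable_sets[OF measurable_component_singleton]) auto
  then have "?Z -` ((\<lambda>g. g t) -` A \<inter> space ?P) \<inter> \<Omega> \<in> sets (vimage_algebra \<Omega> ?Z ?P)"
    by (rule in_vimage_algebra)
  also have "?Z -` ((\<lambda>g. g t) -` A \<inter> space ?P) \<inter> \<Omega> = {\<omega> \<in> \<Omega>. Z t \<omega> \<in> A}"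
    using assms by (auto simp: space_PiM)
  finally show ?thesis .
qed

text \<open>The paths are redefined as 0 on a null set \<open>N\<close> containing all irregular
  ones, and frozen at their time-0 values for negative times. Changes on a null set leave
  characteristic functions, Laplace transforms and joint probabilities at non-negative times
  intact.\<close>

lemma subordinate_brownian_motion_version:
  fixes X :: "real \<Rightarrow> 'w \<Rightarrow> 'a::euclidean_space"
  assumes "subordinate_brownian_motion M \<Psi> X"
  obtains B S where "subordination M B S \<Psi>" "AE \<omega> in M. \<forall>t\<ge>0. X t \<omega> = B (S t \<omega>) \<omega>"
proof -
  obtain B S where B: "brownian_motion M B" and S: "subordinator M \<Psi> S"
    and indep: "prob_space.indep_set M
          (sets (vimage_algebra (space M) (\<lambda>\<omega>. \<lambda>t\<in>{0..}. B t \<omega>) (\<Pi>\<^sub>M t\<in>{0..}. borel)))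
          (sets (vimage_algebra (space M) (\<lambda>\<omega>. \<lambda>t\<in>{0..}. S t \<omega>) (\<Pi>\<^sub>M t\<in>{0..}. borel)))"
    and X: "X = (\<lambda>t \<omega>. B (S t \<omega>) \<omega>)"
    using assms unfolding subordinate_brownian_motion_def by blast
  have lB: "levy_process M B" and cB: "AE \<omega> in M. continuous_on {0..} (\<lambda>t. B t \<omega>)"
    and chB: "\<And>t \<xi>. 0 \<le> t \<Longrightarrow> (CLINT \<omega>|M. iexp (\<xi> \<bullet> B t \<omega>)) = of_real (exp (- t * (norm \<xi>)\<^sup>2))"
    using B by (auto simp: brownian_motion_def)
  have lS: "levy_process M S" and mS: "AE \<omega> in M. mono_on {0..} (\<lambda>t. S t \<omega>)"
    and laS: "\<And>t u. 0 \<le> t \<Longrightarrow> 0 < u \<Longrightarrow> (LINT \<omega>|M. exp (- u * S t \<omega>)) = exp (- t * \<Psi> u)"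
    using S by (auto simp: subordinator_def)
  interpret prob_space M using lB by (simp add: levy_process_def)
  have measB: "B t \<in> borel_measurable M" and measS: "S t \<in> borel_measurable M" if "0 \<le> t" for t
    using lB lS that by (auto simp: levy_process_def)
  have "AE \<omega> in M. S 0 \<omega> = 0"
    and "AE \<omega> in M. (\<forall>t\<ge>0. ((\<lambda>s. S s \<omega>) \<longlongrightarrow> S t \<omega>) (at_right t)) \<and>
        (\<forall>t>0. \<exists>l. ((\<lambda>s. S s \<omega>) \<longlongrightarrow> l) (at_left t))"
    using lS by (simp_all add: levy_process_def)
  with cB mS have "AE \<omega> in M. continuous_on {0..} (\<lambda>t. B t \<omega>) \<and> mono_on {0..} (\<lambda>t. S t \<omega>)
      \<and> S 0 \<omega> = 0 \<and> (\<forall>t\<ge>0. ((\<lambda>s. S s \<omega>) \<longlongrightarrow> S t \<omega>) (at_right t))" (is "AE \<omega> in M. ?good \<omega>")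
    by eventually_elim auto
  then obtain N where N: "{\<omega> \<in> space M. \<not> ?good \<omega>} \<subseteq> N" "N \<in> null_sets M"
    by (rule AE_E) (blast intro: null_setsI)
  have [measurable]: "N \<in> sets M" using N by auto
  have good: "?good \<omega>" if "\<omega> \<in> space M" "\<omega> \<notin> N" for \<omega>
    using N that by blast
  define B' where "B' t \<omega> = (if \<omega> \<in> N then 0 else B (max 0 t) \<omega>)" for t \<omega>
  define S' where "S' t \<omega> = (if \<omega> \<in> N then 0 else S (max 0 t) \<omega>)" for t \<omega>
  have mB'[measurable]: "B' t \<in> borel_measurable M" for t
    unfolding B'_def using measB[of "max 0 t"] by measurable
  have mS'[measurable]: "S' t \<in> borel_measurable M" for t
    unfolding S'_def using measS[of "max 0 t"] by measurable
  have aeB: "AE \<omega> in M. B' t \<omega> = B t \<omega>" and aeS: "AE \<omega> in M. S' t \<omega> = S t \<omega>" if "0 \<le> t" for t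
    using AE_not_in[OF N(2)] that by (auto simp: B'_def S'_def elim!: eventually_mono)
  have "subordination M B' S' \<Psi>"
  proof unfold_locales
    fix \<omega> assume \<omega>: "\<omega> \<in> space M"
    show "continuous_on UNIV (\<lambda>t. B' t \<omega>)"
    proof (cases "\<omega> \<in> N")
      case False
      have "continuous_on UNIV (\<lambda>t. B (max 0 t) \<omega>)"
        using good[OF \<omega> False] by (intro continuous_on_compose2[of "{0..}" "\<lambda>t. B t \<omega>" UNIV "max 0"] continuous_on_max continuous_on_const continuous_on_id) auto
      then show ?thesis using False by (simp add: B'_def)
    qed (simp add: B'_def)
    show "((\<lambda>s. S' s \<omega>) \<longlongrightarrow> S' t \<omega>) (at_right t)" for t
    proof (cases "\<omega> \<in> N")
      case False
      have "((\<lambda>s. S (max 0 s) \<omega>) \<longlongrightarrow> S (max 0 t) \<omega>) (at_right t)"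
      proof (cases "0 \<le> t")
        case True
        have "((\<lambda>s. S s \<omega>) \<longlongrightarrow> S (max 0 t) \<omega>) (at_right t)"
          using good[OF \<omega> False] True by simp
        moreover have "\<forall>\<^sub>F s in at_right t. S s \<omega> = S (max 0 s) \<omega>"
          using eventually_at_right_less[of t] by eventually_elim (use True in simp)
        ultimately show ?thesis by (rule Lim_transform_eventually)
      next
        case neg: False
        then have "\<forall>\<^sub>F s in at_right t. S (max 0 t) \<omega> = S (max 0 s) \<omega>"
          using eventually_at_right_real[of t 0] by (auto elim!: eventually_mono)
        then show ?thesis by (rule Lim_transform_eventually[OF tendsto_const])
      qed
      then show ?thesis using False by (simp add: S'_def)
    qed (simp add: S'_def)
    show "S' s \<omega> \<le> S' t \<omega>" if "s \<le> t" for s t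
      using good[OF \<omega>] that by (auto simp: S'_def intro!: mono_onD[of "{0..}" "\<lambda>t. S t \<omega>"])
    show "0 \<le> S' t \<omega>" for t
    proof (cases "\<omega> \<in> N")
      case False
      have "S 0 \<omega> \<le> S (max 0 t) \<omega>"
        using good[OF \<omega> False] by (intro mono_onD[of "{0..}" "\<lambda>t. S t \<omega>"]) auto
      then show ?thesis using good[OF \<omega> False] False by (simp add: S'_def)
    qed (simp add: S'_def)
  next
    fix t :: real assume t: "0 \<le> t"
    have [measurable]: "B t \<in> borel_measurable M" "S t \<in> borel_measurable M"
      by (simp_all add: measB measS t)
    show "(CLINT \<omega>|M. iexp (\<xi> \<bullet> B' t \<omega>)) = of_real (exp (- t * (norm \<xi>)\<^sup>2))" for \<xi>
      unfolding chB[OF t, symmetric] using aeB[OF t]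
      by (intro integral_cong_AE) (measurable, auto elim!: eventually_mono)
    show "(LINT \<omega>|M. exp (- u * S' t \<omega>)) = exp (- t * \<Psi> u)" if "0 < u" for u
      unfolding laS[OF t that, symmetric] using aeS[OF t]
      by (intro integral_cong_AE) (simp, simp, auto elim!: eventually_mono)
  next
    fix s t :: real and A :: "'a set" and C :: "real set"
    assume st: "0 \<le> s" "0 \<le> t" and [measurable]: "A \<in> sets borel" "C \<in> sets borel"
    have [measurable]: "B t \<in> borel_measurable M" "S s \<in> borel_measurable M"
      by (simp_all add: measB measS st)
    have "prob {\<omega> \<in> space M. B' t \<omega> \<in> A \<and> S' s \<omega> \<in> C} = prob ({\<omega> \<in> space M. B t \<omega> \<in> A} \<inter> {\<omega> \<in> space M. S s \<omega> \<in> C})"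
      using aeB[OF st(2)] aeS[OF st(1)]
      by (intro finite_measure_eq_AE) (measurable, auto)
    also have "\<dots> = prob {\<omega> \<in> space M. B t \<omega> \<in> A} * prob {\<omega> \<in> space M. S s \<omega> \<in> C}"
      by (rule indep_setD[OF indep]) (intro restrict_process_preimage_in_vimage_algebra st; simp)+
    also have "prob {\<omega> \<in> space M. B t \<omega> \<in> A} = prob {\<omega> \<in> space M. B' t \<omega> \<in> A}"
      using aeB[OF st(2)] by (intro finite_measure_eq_AE) (measurable, auto)
    also have "prob {\<omega> \<in> space M. S s \<omega> \<in> C} = prob {\<omega> \<in> space M. S' s \<omega> \<in> C}"
      using aeS[OF st(1)] by (intro finite_measure_eq_AE) (measurable, auto)
    finally show "prob {\<omega> \<in> space M. B' t \<omega> \<in> A \<and> S' s \<omega> \<in> C}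
      = prob {\<omega> \<in> space M. B' t \<omega> \<in> A} * prob {\<omega> \<in> space M. S' s \<omega> \<in> C}" .
  qed (rule mB' mS')+
  moreover have "AE \<omega> in M. \<forall>t\<ge>0. X t \<omega> = B' (S' t \<omega>) \<omega>"
    using AE_not_in[OF N(2)] AE_space
  proof eventually_elim
    case (elim \<omega>)
    \<comment> \<open>Off \<open>N\<close>, \<open>B'\<close> is defined to follow \<open>B\<close>
      only at non-negative times, so the sign of \<open>S t\<close> matters here.\<close>
    have "0 \<le> S t \<omega>" if "0 \<le> t" for t
      using good[OF elim(2,1)] that mono_onD[of "{0..}" "\<lambda>t. S t \<omega>" 0 t] by simp
    then show ?case using elim(1) by (simp add: X B'_def S'_def)
  qed
  ultimately show ?thesis by (rule that)
qed

theorem theorem5p3: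
  fixes M :: "'w measure"
    and X :: "real \<Rightarrow> 'w \<Rightarrow> 'a::euclidean_space"
    and \<Psi> :: "real \<Rightarrow> real"
    and c_lo c_up \<mu>_lo \<mu>_up p :: real
  assumes "\<Psi> \<in> bernstein0"
    and "0 < c_lo" "c_lo \<le> 1" "1 \<le> c_up"
    and "0 < \<mu>_lo" "0 < \<mu>_up" "\<mu>_up < min (real DIM('a) / 2) 1"
    and "\<And>u \<gamma>. 0 < u \<Longrightarrow> 1 \<le> \<gamma> \<Longrightarrow> c_lo * \<gamma> powr \<mu>_lo * \<Psi> u \<le> \<Psi> (\<gamma> * u)"
    and "\<And>u \<gamma>. 0 < u \<Longrightarrow> 1 \<le> \<gamma> \<Longrightarrow> \<Psi> (\<gamma> * u) \<le> c_up * \<gamma> powr \<mu>_up * \<Psi> u"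
    and "subordinate_brownian_motion M \<Psi> X"
    and "transient M X"
    and "1 < p" "p < real DIM('a) / (real DIM('a) - 2 * \<mu>_lo)"
  shows "\<not> (\<exists>\<phi>. super_solution M X p \<phi> \<and> \<phi> \<noteq> (\<lambda>_. 0))"
proof -
  obtain B S where "subordination M B S \<Psi>" and X: "AE \<omega> in M. \<forall>t\<ge>0. X t \<omega> = B (S t \<omega>) \<omega>"
    using subordinate_brownian_motion_version[OF assms(10)] .
  then interpret sub: subordination M B S \<Psi> by simp
  have Y: "AE \<omega> in M. \<forall>t\<ge>0. X t \<omega> = sub.X t \<omega>"
    using X by (simp add: sub.X_def)
  \<comment> \<open>Membership in \<open>bernstein0\<close> gives non-negativity, and transience
    rules out zeros.\<close>
  have pos: "0 < \<Psi> u" if "0 < u" for u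
    using assms(1) sub.transient_imp_exponent_nonzero[OF assms(11) Y that] that
    by (auto simp: bernstein0_def less_le)
  \<comment> \<open>Otherwise the quotient bounding \<open>p\<close> would be at most 0, also in the
    case of equality because division by 0 yields 0; this contradicts p > 1.\<close>
  have "0 < real DIM('a) - 2 * \<mu>_lo"
  proof (rule ccontr)
    assume "\<not> 0 < real DIM('a) - 2 * \<mu>_lo"
    then have "real DIM('a) / (real DIM('a) - 2 * \<mu>_lo) \<le> 0"
      by (intro divide_nonneg_nonpos) auto
    with assms(12,13) show False by linarith
  qed
  then have "p * (real DIM('a) - 2 * \<mu>_lo) < real DIM('a)"
    using assms(13) by (simp add: pos_less_divide_eq)
  then show ?thesis
    using sub.no_super_solution[OF _ Y assms(12) assms(2,3,5,8) pos] by blast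
qed

end
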